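(* The Gaussian shift experiment $\mathcal E_{\rm shift}$ with observation $\boldsymbol\Delta_{\rm shift}$ and the Brownian drift experiment $\mathcal E_{\rm drift}$ with observation $\boldsymbol\Delta_{\rm drift}$, both indexed by $(\boldsymbol\tau,\eta)\in\mathbb R^k\times\Upsilon$ and associated with the same information quantities $\boldsymbol{\mathcal I}_{I,I}$, $\boldsymbol{\mathcal I}_{I,\eta}$, $\mathcal I_{\eta\eta'}$, are equivalent in the sense of the Le Cam distance.
   Context: $\Upsilon$ is a separable infinite-dimensional vector space with origin $0$; $\boldsymbol\tau\in\mathbb R^k$, $\eta\in\Upsilon$. Given are a $k\times k$ information matrix $\boldsymbol{\mathcal I}_{I,I}$, vectors $\boldsymbol{\mathcal I}_{I,\eta}\in\mathbb R^k$ and scalars $\mathcal I_{\eta\eta'}=\mathcal I_{\eta'\eta}$ ($\eta,\eta'\in\Upsilon$), with $\boldsymbol{\mathcal I}_{I,0}=\mathbf 0$ and $\mathcal I_{0\,\eta'}=0$, such that for all $\ell\in\mathbb N$ and $\eta_1,\dots,\eta_\ell\in\Upsilon$ the $(k+\ell)\times(k+\ell)$ matrix $\boldsymbol{\mathcal I}_{\eta_1,\dots,\eta_\ell}$ with upper-left block $\boldsymbol{\mathcal I}_{I,I}$, upper-right block $(\boldsymbol{\mathcal I}_{I,\eta_1},\dots,\boldsymbol{\mathcal I}_{I,\eta_\ell})$, lower-left block its transpose, and lower-right block $(\mathcal I_{\eta_i\eta_j})_{i,j}$ is a covariance matrix, of full rank whenever $\eta_1,\dots,\eta_\ell$ are linearly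 independent. (These are the information quantities at $(\boldsymbol\theta_0,\boldsymbol\vartheta_0)$ of a locally asymptotically normal sequence of experiments, for which both experiments below serve as limits of the local experiments.) Gaussian shift experiment $\mathcal E_{\rm shift}$: the observation is a Gaussian process $\boldsymbol\Delta_{\rm shift}=\big(\boldsymbol\Delta_{\rm int}\in\mathbb R^k,\ \{\Delta_{{\rm nuis},\eta'}\in\mathbb R:\eta'\in\Upsilon\}\big)$ such that, under $\mathbb P_{\boldsymbol\tau,\eta}$, each $(\boldsymbol\Delta_{\rm int}^\top,\Delta_{{\rm nuis},\eta_1},\dots,\Delta_{{\rm nuis},\eta_\ell})^\top$ is Gaussian with covariance matrix $\boldsymbol{\mathcal I}_{\eta_1,\dots,\eta_\ell}$ and mean $\boldsymbol{\mathcal I}_{I,I}\boldsymbol\tau+\boldsymbol{\mathcal I}_{I,\eta}$ for $\boldsymbol\Delta_{\rm int}$ and $\boldsymbol{\mathcal I}_{I,\eta_i}^\top\boldsymbol\tau+\mathcal I_{\eta_i\eta}$ for $\Delta_{{\rm nuis},\eta_i}$. Brownian drift experiment $\mathcal E_{\rm drift}$: the observation is $\boldsymbol\Delta_{\rm drift}=\big\{\boldsymbol\Delta_{\rm int}(u)\in\mathbb R^k,\ \{\Delta_{{\rm nuis},\eta'}(u)\in\mathbb R:\eta'\in\Upsilon\}:u\in[0,1]\big\}$, such that under $\mathbb P_{\mathbf 0,0}$ each $(\boldsymbol\Delta_{\rm int}^\top,\Delta_{{\rm nuis},\eta_1},\dots,\Delta_{{\rm nuis},\eta_\ell})^\top$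 is a multivariate Brownian motion with zero drift and covariance matrix $\boldsymbol{\mathcal I}_{\eta_1,\dots,\eta_\ell}$ at $u=1$, and under $\mathbb P_{\boldsymbol\tau,\eta}$ the covariance structure is the same but the drifts are $\boldsymbol{\mathcal I}_{I,I}\boldsymbol\tau+\boldsymbol{\mathcal I}_{I,\eta}$ for $\boldsymbol\Delta_{\rm int}$ and $\boldsymbol{\mathcal I}_{I,\eta'}^\top\boldsymbol\tau+\mathcal I_{\eta\eta'}$ for $\Delta_{{\rm nuis},\eta'}$. Two experiments indexed by the same $(\boldsymbol\tau,\eta)$ are equivalent in the sense of the Le Cam distance if, for all finite $\ell$ and all $(\boldsymbol\tau_1,\eta_1),\dots,(\boldsymbol\tau_\ell,\eta_\ell)\in\mathbb R^k\times\Upsilon$, the joint distributions, each under its own $\mathbb P_{\mathbf 0,0}$, of the $\ell$-tuples $\big(\log(\mathrm d\mathbb P_{\boldsymbol\tau_1,\eta_1}/\mathrm d\mathbb P_{\mathbf 0,0}),\dots,\log(\mathrm d\mathbb P_{\boldsymbol\tau_\ell,\eta_\ell}/\mathrm d\mathbb P_{\mathbf 0,0})\big)$ coincide ($\mathrm d\mathrm P/\mathrm d\mathrm Q$ is the Radon-Nikodym derivative of the part of $\mathrm P$ absolutely continuous with respect to $\mathrm Q$). *)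

theory Defs
  imports "HOL-Probability.Probability"
begin

section \<open>Vectors and matrices over a finite index set\<close>

text \<open>
  The matrices below have size \<open>k + \<ell>\<close> with \<open>\<ell>\<close> varying, so they are indexed by the finite set
  \<open>UNIV <+> {..<\<ell>}\<close> inside the type \<open>'k + nat\<close>, where \<open>k = CARD('k)\<close>.
\<close>

definition stack :: "real^'k \<Rightarrow> (nat \<Rightarrow> real) \<Rightarrow> 'k + nat \<Rightarrow> real" where
  "stack x y = case_sum (\<lambda>i. x $ i) y"

text \<open>The rank is the largest size of a linearly independent set of columns.\<close>

definition matrix_rank :: "'i set \<Rightarrow> ('i \<Rightarrow> 'i \<Rightarrow> real) \<Rightarrow> nat" where
  "matrix_rank S A = Max (card ` {T. T \<subseteq> S \<and>
     (\<forall>c. (\<forall>i\<in>S. (\<Sum>j\<in>T. c j * A i j) = 0) \<longrightarrow> (\<forall>j\<in>T. c j = 0))})"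

definition covariance :: "'a measure \<Rightarrow> ('a \<Rightarrow> real) \<Rightarrow> ('a \<Rightarrow> real) \<Rightarrow> real" where
  "covariance M X Y =
     (\<integral>\<omega>. (X \<omega> - (\<integral>\<omega>'. X \<omega>' \<partial>M)) * (Y \<omega> - (\<integral>\<omega>'. Y \<omega>' \<partial>M)) \<partial>M)"

definition is_covariance_matrix :: "'i set \<Rightarrow> ('i \<Rightarrow> 'i \<Rightarrow> real) \<Rightarrow> bool" where
  "is_covariance_matrix S A \<longleftrightarrow>
     (\<exists>M :: ('i \<Rightarrow> real) measure. prob_space M \<and> sets M = sets (\<Pi>\<^sub>M i\<in>S. borel) \<and>
        (\<forall>i\<in>S. integrable M (\<lambda>x. (x i)\<^sup>2)) \<and>
        (\<forall>i\<in>S. \<forall>j\<in>S. covariance M (\<lambda>x. x i) (\<lambda>x. x j) = A i j))"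


section \<open>Gaussian vectors and Brownian motion\<close>

text \<open>
  The library has no degenerate normal distribution. It is needed here because covariance
  matrices may be singular (already \<open>\<Delta>\<^sub>n\<^sub>u\<^sub>i\<^sub>s\<^sub>,\<^sub>0\<close> has variance \<open>0\<close>).
\<close>

definition normal_law :: "real \<Rightarrow> real \<Rightarrow> real measure" where
  "normal_law \<mu> \<sigma> =
     (if \<sigma> = 0 then return borel \<mu> else density lborel (\<lambda>x. ennreal (normal_density \<mu> \<sigma> x)))"

definition jointly_gaussian :: "'a measure \<Rightarrow> 'i set \<Rightarrow> ('i \<Rightarrow> 'a \<Rightarrow> real) \<Rightarrow> bool" where
  "jointly_gaussian M S X \<longleftrightarrow>
     (\<forall>i\<in>S. X i \<in> borel_measurable M) \<and>
     (\<forall>a. \<exists>\<mu>. \<exists>\<sigma>\<ge>0. distr M borel (\<lambda>\<omega>. \<Sum>i\<in>S. a i * X i \<omega>) = normal_law \<mu> \<sigma>)"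

definition gaussian_vector ::
  "'a measure \<Rightarrow> 'i set \<Rightarrow> ('i \<Rightarrow> 'a \<Rightarrow> real) \<Rightarrow> ('i \<Rightarrow> real) \<Rightarrow> ('i \<Rightarrow> 'i \<Rightarrow> real) \<Rightarrow> bool" where
  "gaussian_vector M S X m A \<longleftrightarrow>
     jointly_gaussian M S X \<and>
     (\<forall>i\<in>S. (\<integral>\<omega>. X i \<omega> \<partial>M) = m i) \<and>
     (\<forall>i\<in>S. \<forall>j\<in>S. covariance M (X i) (X j) = A i j)"

text \<open>
  Multivariate Brownian motion \<open>W\<close> on \<open>[0,1]\<close> with drift \<open>b\<close> (per unit of time) and covariance
  matrix \<open>A\<close> at time \<open>1\<close>.
\<close>

definition brownian_motion ::
  "'a measure \<Rightarrow> 'i set \<Rightarrow> ('i \<Rightarrow> real \<Rightarrow> 'a \<Rightarrow> real) \<Rightarrow> ('i \<Rightarrow> real) \<Rightarrow> ('i \<Rightarrow> 'i \<Rightarrow> real) \<Rightarrow> bool" where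
  "brownian_motion M S W b A \<longleftrightarrow>
     (\<forall>i\<in>S. \<forall>u\<in>{0..1}. W i u \<in> borel_measurable M) \<and>
     (AE \<omega> in M. \<forall>i\<in>S. W i 0 \<omega> = 0) \<and>
     (AE \<omega> in M. \<forall>i\<in>S. continuous_on {0..1} (\<lambda>u. W i u \<omega>)) \<and>
     (\<forall>n (t :: nat \<Rightarrow> real). 0 \<le> t 0 \<and> (\<forall>j<n. t j < t (Suc j)) \<and> t n \<le> 1 \<longrightarrow>
        prob_space.indep_vars M (\<lambda>_. \<Pi>\<^sub>M i\<in>S. borel)
          (\<lambda>j \<omega>. \<lambda>i\<in>S. W i (t (Suc j)) \<omega> - W i (t j) \<omega>) {..<n}) \<and>
     (\<forall>s u. 0 \<le> s \<and> s < u \<and> u \<le> 1 \<longrightarrow>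
        gaussian_vector M S (\<lambda>i \<omega>. W i u \<omega> - W i s \<omega>)
          (\<lambda>i. (u - s) * b i) (\<lambda>i j. (u - s) * A i j))"


section \<open>Experiments and Le Cam equivalence\<close>

definition singular_measures :: "'a measure \<Rightarrow> 'a measure \<Rightarrow> bool" where
  "singular_measures Q R \<longleftrightarrow>
     (\<exists>N\<in>sets Q. emeasure Q N = 0 \<and> emeasure R (space Q - N) = 0)"

definition is_ac_part :: "'a measure \<Rightarrow> 'a measure \<Rightarrow> 'a measure \<Rightarrow> bool" where
  "is_ac_part P Q P' \<longleftrightarrow>
     sets P' = sets P \<and> absolutely_continuous Q P' \<and>
     (\<exists>R. sets R = sets P \<and> singular_measures Q R \<and>
        (\<forall>A\<in>sets P. emeasure P A = emeasure P' A + emeasure R A))"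

lemma is_ac_part_unique:
  assumes sets: "sets P = sets Q" and "is_ac_part P Q P1" "is_ac_part P Q P2"
  shows "P1 = P2"
proof -
  obtain R1 N1 where 1: "sets P1 = sets P" "absolutely_continuous Q P1" "sets R1 = sets P"
      "N1 \<in> sets Q" "emeasure Q N1 = 0" "emeasure R1 (space Q - N1) = 0"
      "\<And>A. A \<in> sets P \<Longrightarrow> emeasure P A = emeasure P1 A + emeasure R1 A"
    using assms(2) unfolding is_ac_part_def singular_measures_def by blast
  obtain R2 N2 where 2: "sets P2 = sets P" "absolutely_continuous Q P2" "sets R2 = sets P"
      "N2 \<in> sets Q" "emeasure Q N2 = 0" "emeasure R2 (space Q - N2) = 0"
      "\<And>A. A \<in> sets P \<Longrightarrow> emeasure P A = emeasure P2 A + emeasure R2 A"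
    using assms(3) unfolding is_ac_part_def singular_measures_def by blast
  define N where "N = N1 \<union> N2"
  have N: "N \<in> sets Q" "N \<in> null_sets Q"
    using 1 2 by (auto simp: N_def intro!: null_sets.Un)
  have ac: "emeasure P' A = emeasure P (A - N)"
    if P': "sets P' = sets P" "absolutely_continuous Q P'" and R: "sets R = sets P"
      "emeasure R (space Q - N') = 0" "N' \<subseteq> N" "N' \<in> sets Q"
      and eq: "\<And>A. A \<in> sets P \<Longrightarrow> emeasure P A = emeasure P' A + emeasure R A"
      and A: "A \<in> sets P" for P' R N' A
  proof -
    have "N \<in> null_sets P'"
      using P' N unfolding absolutely_continuous_def by auto
    then have "emeasure P' A = emeasure P' (A - N)"
      using A P' by (simp add: emeasure_Diff_null_set)
    moreover have "emeasure R (A - N) = 0"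
    proof -
      have "A - N \<subseteq> space Q - N'"
        using A R sets sets.sets_into_space by blast
      then have "emeasure R (A - N) \<le> emeasure R (space Q - N')"
        using R sets by (intro emeasure_mono) auto
      then show ?thesis using R by simp
    qed
    moreover have "A - N \<in> sets P" using A N sets by auto
    ultimately show ?thesis using eq[of "A - N"] by simp
  qed
  show ?thesis
  proof (rule measure_eqI)
    show "sets P1 = sets P2" using 1 2 by simp
    fix A assume "A \<in> sets P1"
    then show "emeasure P1 A = emeasure P2 A"
      using ac[OF 1(1,2,3,6) _ 1(4) 1(7), of A] ac[OF 2(1,2,3,6) _ 2(4) 2(7), of A] 1(1)
      by (simp add: N_def)
  qed
qed

lemma is_ac_part_exists:
  assumes sets: "sets P = sets Q" and "finite_measure P"
  shows "\<exists>P'. is_ac_part P Q P'"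
proof -
  interpret P: finite_measure P by fact
  have ne: "null_sets Q \<noteq> {}" by blast
  obtain f :: "nat \<Rightarrow> ennreal" where f: "range f \<subseteq> emeasure P ` null_sets Q"
      "(SUP N\<in>null_sets Q. emeasure P N) = (SUP n. f n)"
    using ennreal_SUP_countable_SUP[OF ne, of "emeasure P"] by auto
  have "\<forall>n. \<exists>N. N \<in> null_sets Q \<and> f n = emeasure P N" using f(1) by blast
  then obtain g where g: "\<And>n. g n \<in> null_sets Q" "\<And>n. f n = emeasure P (g n)" by metis
  define N where "N = (\<Union>n. g n)"
  have NQ: "N \<in> null_sets Q" unfolding N_def using g by blast
  then have NP: "N \<in> sets P" using sets by auto
  have max: "emeasure P A \<le> emeasure P N" if "A \<in> null_sets Q" for A
  proof -
    have "emeasure P A \<le> (SUP n. f n)" using that f(2) by (metis SUP_upper)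
    also have "\<dots> \<le> emeasure P N"
      unfolding g(2) using NP by (intro SUP_least emeasure_mono) (auto simp: N_def)
    finally show ?thesis .
  qed
  have diff: "emeasure P (A - N) = 0" if A: "A \<in> null_sets Q" for A
  proof -
    have AP: "A \<in> sets P" using A sets by auto
    have "emeasure P (N \<union> (A - N)) = emeasure P N + emeasure P (A - N)"
      using NP AP by (intro plus_emeasure[symmetric]) auto
    moreover have "N \<union> (A - N) \<in> null_sets Q"
      using A NQ by (simp add: null_sets.Un)
    ultimately have "emeasure P N + emeasure P (A - N) \<le> emeasure P N + 0"
      using max by fastforce
    then show ?thesis
      using P.emeasure_finite[of N] by (metis ennreal_add_left_cancel_le le_zero_eq infinity_ennreal_def)
  qed
  define P' R where "P' = density P (indicator (space P - N))" and "R = density P (indicator N)"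
  have P': "emeasure P' A = emeasure P (A - N)" if "A \<in> sets P" for A
  proof -
    have "emeasure P' A = emeasure P ((space P - N) \<inter> A)"
      unfolding P'_def using that NP
      by (simp add: emeasure_density flip: indicator_inter_arith)
    also have "(space P - N) \<inter> A = A - N" using that sets.sets_into_space by blast
    finally show ?thesis .
  qed
  have R: "emeasure R A = emeasure P (A \<inter> N)" if "A \<in> sets P" for A
    unfolding R_def using that NP
    by (simp add: emeasure_density Int_commute flip: indicator_inter_arith)
  have "is_ac_part P Q P'"
    unfolding is_ac_part_def
  proof (intro conjI exI[of _ R] ballI)
    show "absolutely_continuous Q P'"
      unfolding absolutely_continuous_def
    proof
      fix A assume A: "A \<in> null_sets Q"
      then have "A \<in> sets P" using sets by auto
      then show "A \<in> null_sets P'" using diff[OF A] P' by (auto simp: null_sets_def P'_def)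
    qed
    have "space Q - N \<in> sets P" using NQ sets by auto
    then have "emeasure R (space Q - N) = 0" using R[of "space Q - N"] by (simp add: Int_commute)
    then show "singular_measures Q R" unfolding singular_measures_def using NQ by auto
    fix A assume A: "A \<in> sets P"
    have "emeasure P ((A - N) \<union> (A \<inter> N)) = emeasure P (A - N) + emeasure P (A \<inter> N)"
      using A NP by (intro plus_emeasure[symmetric]) auto
    then show "emeasure P A = emeasure P' A + emeasure R A"
      using P'[OF A] R[OF A] by (simp add: Un_Diff_Int)
  qed (simp_all add: P'_def R_def)
  then show ?thesis by blast
qed

definition ac_part :: "'a measure \<Rightarrow> 'a measure \<Rightarrow> 'a measure" where
  "ac_part P Q = (THE P'. is_ac_part P Q P')"

definition ln_ennreal :: "ennreal \<Rightarrow> ereal" where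
  "ln_ennreal x = (if x = 0 then -\<infinity> else if x = \<infinity> then \<infinity> else ereal (ln (enn2real x)))"

definition log_likelihood_ratio :: "'a measure \<Rightarrow> 'a measure \<Rightarrow> 'a \<Rightarrow> ereal" where
  "log_likelihood_ratio P Q \<omega> = ln_ennreal (RN_deriv Q (ac_part P Q) \<omega>)"

lemma measurable_log_likelihood_ratio:
  "log_likelihood_ratio P Q \<in> borel_measurable Q"
  unfolding log_likelihood_ratio_def ln_ennreal_def by measurable

text \<open>
  \<open>E\<close> is an experiment (a family of probability measures on one measurable space) in which the
  process \<open>(X\<^sub>t)\<close>, \<open>t \<in> T\<close>, is observed: the \<open>\<sigma>\<close>-algebra is the one generated by the observation,
  so that the measures of the family are determined by the law of the observation.
\<close>

definition experiment_observing ::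
  "('p \<Rightarrow> 'a measure) \<Rightarrow> 't set \<Rightarrow> ('t \<Rightarrow> 'a \<Rightarrow> real) \<Rightarrow> bool" where
  "experiment_observing E T X \<longleftrightarrow>
     (\<forall>\<theta>. prob_space (E \<theta>)) \<and>
     (\<exists>\<Omega>. \<forall>\<theta>. sets (E \<theta>) = sets (vimage_algebra \<Omega> (\<lambda>\<omega>. \<lambda>t\<in>T. X t \<omega>) (\<Pi>\<^sub>M t\<in>T. borel)))"

definition le_cam_equivalent ::
  "'p \<Rightarrow> ('p \<Rightarrow> 'a measure) \<Rightarrow> ('p \<Rightarrow> 'b measure) \<Rightarrow> bool" where
  "le_cam_equivalent \<theta>\<^sub>0 E F \<longleftrightarrow>
     (\<forall>(l :: nat) (\<theta> :: nat \<Rightarrow> 'p).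
        distr (E \<theta>\<^sub>0) (\<Pi>\<^sub>M i\<in>{..<l}. borel)
          (\<lambda>\<omega>. \<lambda>i\<in>{..<l}. log_likelihood_ratio (E (\<theta> i)) (E \<theta>\<^sub>0) \<omega>) =
        distr (F \<theta>\<^sub>0) (\<Pi>\<^sub>M i\<in>{..<l}. borel)
          (\<lambda>\<omega>. \<lambda>i\<in>{..<l}. log_likelihood_ratio (F (\<theta> i)) (F \<theta>\<^sub>0) \<omega>))"


section \<open>Information quantities and the two limit experiments\<close>

fun info_matrix ::
  "real^'k^'k \<Rightarrow> ('h \<Rightarrow> real^'k) \<Rightarrow> ('h \<Rightarrow> 'h \<Rightarrow> real) \<Rightarrow> (nat \<Rightarrow> 'h) \<Rightarrow> 'k + nat \<Rightarrow> 'k + nat \<Rightarrow> real"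
where
  "info_matrix J\<^sub>I\<^sub>I J\<^sub>I J \<eta>s (Inl i) (Inl j) = J\<^sub>I\<^sub>I $ i $ j"
| "info_matrix J\<^sub>I\<^sub>I J\<^sub>I J \<eta>s (Inl i) (Inr b) = J\<^sub>I (\<eta>s b) $ i"
| "info_matrix J\<^sub>I\<^sub>I J\<^sub>I J \<eta>s (Inr a) (Inl j) = J\<^sub>I (\<eta>s a) $ j"
| "info_matrix J\<^sub>I\<^sub>I J\<^sub>I J \<eta>s (Inr a) (Inr b) = J (\<eta>s a) (\<eta>s b)"

locale information_quantities =
  fixes J\<^sub>I\<^sub>I :: "real^'k^'k" and J\<^sub>I :: "'h::real_vector \<Rightarrow> real^'k" and J :: "'h \<Rightarrow> 'h \<Rightarrow> real"
  assumes J_sym: "J \<eta> \<eta>' = J \<eta>' \<eta>"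
    and J\<^sub>I_zero: "J\<^sub>I 0 = 0"
    and J_zero: "J 0 \<eta>' = 0"
    and info_matrix_covariance:
      "is_covariance_matrix (UNIV <+> {..<l}) (info_matrix J\<^sub>I\<^sub>I J\<^sub>I J \<eta>s)"
    and info_matrix_full_rank:
      "inj_on \<eta>s {..<l} \<Longrightarrow> independent (\<eta>s ` {..<l}) \<Longrightarrow>
        matrix_rank (UNIV <+> {..<l}) (info_matrix J\<^sub>I\<^sub>I J\<^sub>I J \<eta>s) = CARD('k) + l"

text \<open>The mean (shift) or drift of \<open>(\<Delta>\<^sub>i\<^sub>n\<^sub>t, \<Delta>\<^sub>n\<^sub>u\<^sub>i\<^sub>s\<close> in the directions \<open>\<eta>s)\<close> under the parameter \<open>(\<tau>, \<eta>)\<close>;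
  \<open>J \<eta>' \<eta> = J \<eta> \<eta>'\<close> by symmetry.\<close>

definition local_mean ::
  "real^'k^'k \<Rightarrow> ('h \<Rightarrow> real^'k) \<Rightarrow> ('h \<Rightarrow> 'h \<Rightarrow> real) \<Rightarrow> real^'k \<Rightarrow> 'h \<Rightarrow> (nat \<Rightarrow> 'h) \<Rightarrow> 'k + nat \<Rightarrow> real"
where
  "local_mean J\<^sub>I\<^sub>I J\<^sub>I J \<tau> \<eta> \<eta>s =
     stack (J\<^sub>I\<^sub>I *v \<tau> + J\<^sub>I \<eta>) (\<lambda>a. J\<^sub>I (\<eta>s a) \<bullet> \<tau> + J (\<eta>s a) \<eta>)"

definition gaussian_shift_experiment ::
  "real^'k^'k \<Rightarrow> ('h \<Rightarrow> real^'k) \<Rightarrow> ('h \<Rightarrow> 'h \<Rightarrow> real) \<Rightarrow>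
   ((real^'k) \<times> 'h \<Rightarrow> 'a measure) \<Rightarrow> ('a \<Rightarrow> real^'k) \<Rightarrow> ('h \<Rightarrow> 'a \<Rightarrow> real) \<Rightarrow> bool"
where
  "gaussian_shift_experiment J\<^sub>I\<^sub>I J\<^sub>I J P \<Delta>int \<Delta>nuis \<longleftrightarrow>
     experiment_observing P UNIV (case_sum (\<lambda>i \<omega>. \<Delta>int \<omega> $ i) \<Delta>nuis) \<and>
     (\<forall>\<tau> \<eta> l \<eta>s. gaussian_vector (P (\<tau>, \<eta>)) (UNIV <+> {..<l})
        (\<lambda>c \<omega>. stack (\<Delta>int \<omega>) (\<lambda>a. \<Delta>nuis (\<eta>s a) \<omega>) c)
        (local_mean J\<^sub>I\<^sub>I J\<^sub>I J \<tau> \<eta> \<eta>s) (info_matrix J\<^sub>I\<^sub>I J\<^sub>I J \<eta>s))"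

text \<open>
  The drift under \<open>(0, 0)\<close> vanishes by \<open>J\<^sub>I 0 = 0\<close> and \<open>J \<eta>' 0 = 0\<close>.
\<close>

definition brownian_drift_experiment ::
  "real^'k^'k \<Rightarrow> ('h \<Rightarrow> real^'k) \<Rightarrow> ('h \<Rightarrow> 'h \<Rightarrow> real) \<Rightarrow>
   ((real^'k) \<times> 'h \<Rightarrow> 'a measure) \<Rightarrow> (real \<Rightarrow> 'a \<Rightarrow> real^'k) \<Rightarrow> ('h \<Rightarrow> real \<Rightarrow> 'a \<Rightarrow> real) \<Rightarrow> bool"
where
  "brownian_drift_experiment J\<^sub>I\<^sub>I J\<^sub>I J P \<Delta>int \<Delta>nuis \<longleftrightarrow>
     experiment_observing P (UNIV \<times> {0..1})
       (\<lambda>(c, u). case_sum (\<lambda>i \<omega>. \<Delta>int u \<omega> $ i) (\<lambda>\<eta>' \<omega>. \<Delta>nuis \<eta>' u \<omega>) c) \<and>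
     (\<forall>\<tau> \<eta> l \<eta>s. brownian_motion (P (\<tau>, \<eta>)) (UNIV <+> {..<l})
        (\<lambda>c u \<omega>. stack (\<Delta>int u \<omega>) (\<lambda>a. \<Delta>nuis (\<eta>s a) u \<omega>) c)
        (local_mean J\<^sub>I\<^sub>I J\<^sub>I J \<tau> \<eta> \<eta>s) (info_matrix J\<^sub>I\<^sub>I J\<^sub>I J \<eta>s))"

end

theory Submission
  imports Defs
begin

text \<open>
  In both experiments \<open>P\<^sub>\<tau>\<^sub>,\<^sub>\<eta>\<close> has the density \<open>exp (Z - v / 2)\<close> with respect to \<open>P\<^sub>0\<^sub>,\<^sub>0\<close>, where
  \<open>Z = \<tau> \<bullet> \<Delta>\<^sub>i\<^sub>n\<^sub>t + \<Delta>\<^sub>n\<^sub>u\<^sub>i\<^sub>s\<^sub>,\<^sub>\<eta>\<close> (taken at time \<open>1\<close> in the drift experiment) and \<open>v\<close> is the variance of \<open>Z\<close>: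
  tilting a centred Gaussian process by \<open>exp (Z - v / 2)\<close> keeps its covariance and adds to its mean the
  covariance with \<open>Z\<close>, which is exactly the prescribed mean or drift, and the law of the observation
  determines the measure. The log likelihood ratios \<open>Z - v / 2\<close> under \<open>P\<^sub>0\<^sub>,\<^sub>0\<close> are jointly Gaussian with
  the same means and covariances in both experiments. Laws are identified throughout by the
  characteristic functions of linear combinations (Cramer--Wold).
\<close>

section \<open>Uniqueness of characteristic functions\<close>

text \<open>Covariances may be singular and there are infinitely many coordinates, so there is no
  joint Lebesgue density to compare; every law is handled through finite linear combinations.
  Uniqueness of characteristic functions is applied only on the real line. Several coordinates are
  reached one at a time, by turning an event about one coordinate into a weight of the measure,
  which is why the basic statements concern finite measures and bounded complex weights. The same
  weighted statement expresses independence in the tilting step, without any conditional law. The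
  two experiments differ in index set and covariance kernel, but the joint law of the log likelihood
  ratios involves only the covariances of the variables \<open>Z\<close>, so no map between the two
  observations has to be constructed.\<close>

lemma borel_measurable_cis [measurable]: "cis \<in> borel_measurable borel"
  by (intro borel_measurable_continuous_onI continuous_intros)

lemma borel_measurable_cnj [measurable]: "cnj \<in> borel_measurable borel"
  by (intro borel_measurable_continuous_onI continuous_intros)

lemma (in finite_measure) integrable_cis:
  "f \<in> borel_measurable M \<Longrightarrow> integrable M (\<lambda>x. cis (f x))"
  by (intro integrable_const_bound[where B = 1]) auto

text \<open>At \<open>t = 0\<close> the hypothesis says that the total masses agree. Dividing by
  this common mass reduces the claim to Levy uniqueness for probability laws; mass zero is treated
  apart. Finite measures are needed because the weighted measures used later are not
  normalised.\<close>

lemma finite_measure_eqI_char: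
  fixes M N :: "real measure"
  assumes "finite_measure M" "finite_measure N"
    and [measurable_cong, simp]: "sets M = sets borel" "sets N = sets borel"
    and eq: "\<And>t. (CLINT x|M. cis (t * x)) = (CLINT x|N. cis (t * x))"
  shows "M = N"
proof -
  interpret M: finite_measure M by fact
  interpret N: finite_measure N by fact
  have sp [simp]: "space M = UNIV" "space N = UNIV"
    using sets_eq_imp_space_eq[of M borel] sets_eq_imp_space_eq[of N borel] by auto
  define m where "m = measure M UNIV"
  have m: "measure N UNIV = m"
    using eq[of 0] by (simp add: m_def)
  have eM: "emeasure M UNIV = ennreal m" and eN: "emeasure N UNIV = ennreal m"
    using m by (simp_all add: m_def M.emeasure_eq_measure N.emeasure_eq_measure)
  show ?thesis
  proof (cases "m = 0")
    case True
    have "emeasure M A = 0" "emeasure N A = 0" for A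
      using emeasure_mono[of A UNIV M] emeasure_mono[of A UNIV N] eM eN True
      by (auto simp: le_zero_eq)
    then show ?thesis by (intro measure_eqI) auto
  next
    case False
    then have mpos: "m > 0" by (simp add: m_def zero_less_measure_iff order_less_le)
    define c where "c = (\<lambda>_ :: real. ennreal (1 / m))"
    have char: "char (density M c) = char (density N c)"
      unfolding char_def c_def using mpos
      by (auto simp: fun_eq_iff integral_density cis_conv_exp[symmetric] eq simp flip: of_real_mult)
    have "real_distribution (density K c)"
      if [measurable_cong, simp]: "sets K = sets borel" and K: "emeasure K UNIV = ennreal m"
      for K
    proof -
      have [simp]: "space K = UNIV" using sets_eq_imp_space_eq[OF that(1)] by simp
      have "emeasure (density K c) (space (density K c)) = 1"
        using mpos by (simp add: c_def emeasure_density nn_integral_cmult_indicator K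
            flip: ennreal_mult)
      then have "prob_space (density K c)" by (rule prob_spaceI)
      then show ?thesis by (simp add: real_distribution_def real_distribution_axioms_def)
    qed
    then have "density M c = density N c"
      using Levy_uniqueness char eM eN by simp
    moreover have "density (density K c) (\<lambda>_. ennreal m) = K"
      if [measurable_cong]: "sets K = sets borel" for K
      using mpos by (subst density_density_eq) (auto simp: c_def density_1 simp flip: ennreal_mult)
    ultimately show ?thesis
      by (metis \<open>sets M = sets borel\<close> \<open>sets N = sets borel\<close>)
  qed
qed

text \<open>Uniqueness on the line, applied to the images of the weighted measures: the weight may
  depend on more than the observed variable, and it enters the image law as an extra density on the
  source space.\<close>

lemma distr_density_eqI_char:
  fixes V :: "'a \<Rightarrow> real" and V' :: "'b \<Rightarrow> real"
  assumes [measurable]: "V \<in> borel_measurable M" "V' \<in> borel_measurable N"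
    and h: "integrable M h" "\<And>x. 0 \<le> h x" "integrable N h'" "\<And>x. 0 \<le> h' x"
    and eq: "\<And>t. (CLINT x|M. h x * cis (t * V x)) = (CLINT x|N. h' x * cis (t * V' x))"
  shows "distr (density M (\<lambda>x. ennreal (h x))) borel V = distr (density N (\<lambda>x. ennreal (h' x))) borel V'"
proof (rule finite_measure_eqI_char)
  note [measurable] = borel_measurable_integrable[OF h(1)] borel_measurable_integrable[OF h(3)]
  show "finite_measure (distr (density M (\<lambda>x. ennreal (h x))) borel V)"
    by (intro finite_measure.finite_measure_distr finite_measureI)
       (use h in \<open>auto simp: emeasure_density nn_integral_eq_integral\<close>)
  show "finite_measure (distr (density N (\<lambda>x. ennreal (h' x))) borel V')"
    by (intro finite_measure.finite_measure_distr finite_measureI)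
       (use h in \<open>auto simp: emeasure_density nn_integral_eq_integral\<close>)
  show "(CLINT x|distr (density M (\<lambda>x. ennreal (h x))) borel V. cis (t * x)) =
        (CLINT x|distr (density N (\<lambda>x. ennreal (h' x))) borel V'. cis (t * x))" for t
    using eq[of t] h by (simp add: integral_distr integral_density scaleR_conv_of_real)
qed auto

text \<open>The complex weight is split into the nonnegative weights \<open>1\<close>, \<open>1 + Re h\<close> and \<open>1 + Im h\<close>,
  to which uniqueness of characteristic functions of measures applies.\<close>

lemma weighted_integral_eqI_char:
  fixes V :: "'a \<Rightarrow> real" and V' :: "'b \<Rightarrow> real" and g :: "real \<Rightarrow> complex"
  assumes "finite_measure M" "finite_measure N"
    and [measurable]: "V \<in> borel_measurable M" "V' \<in> borel_measurable N"
      "h \<in> borel_measurable M" "h' \<in> borel_measurable N" "g \<in> borel_measurable borel"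
    and h: "\<And>x. norm (h x) \<le> 1" "\<And>x. norm (h' x) \<le> 1"
    and eq: "\<And>t. (CLINT x|M. cis (t * V x)) = (CLINT x|N. cis (t * V' x))"
    and eqh: "\<And>t. (CLINT x|M. h x * cis (t * V x)) = (CLINT x|N. h' x * cis (t * V' x))"
    and g: "integrable M (\<lambda>x. g (V x))"
  shows "(CLINT x|M. h x * g (V x)) = (CLINT x|N. h' x * g (V' x))"
proof -
  interpret M: finite_measure M by fact
  interpret N: finite_measure N by fact
  have Re1: "\<bar>Re (h x)\<bar> \<le> 1" "\<bar>Im (h x)\<bar> \<le> 1" for x
    using h(1)[of x] abs_Re_le_cmod[of "h x"] abs_Im_le_cmod[of "h x"] by linarith+
  have Re2: "\<bar>Re (h' x)\<bar> \<le> 1" "\<bar>Im (h' x)\<bar> \<le> 1" for x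
    using h(2)[of x] abs_Re_le_cmod[of "h' x"] abs_Im_le_cmod[of "h' x"] by linarith+
  have nn: "0 \<le> 1 + Re (h x)" "0 \<le> 1 + Im (h x)" "0 \<le> 1 + Re (h' x')" "0 \<le> 1 + Im (h' x')" for x x'
    using Re1[of x] Re2[of x'] by linarith+
  have le2: "1 + Re (h x) \<le> 2" "1 + Im (h x) \<le> 2" "1 + Re (h' x') \<le> 2" "1 + Im (h' x') \<le> 2" for x x'
    using Re1[of x] Re2[of x'] by linarith+
  have intM: "integrable M (\<lambda>x. h x * cis (t * V x))" "integrable M (\<lambda>x. cnj (h x) * cis (t * V x))" for t
    using h(1) by (auto intro!: M.integrable_const_bound[where B = 1] simp: norm_mult)
  have intN: "integrable N (\<lambda>x. h' x * cis (t * V' x))" "integrable N (\<lambda>x. cnj (h' x) * cis (t * V' x))" for t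
    using h(2) by (auto intro!: N.integrable_const_bound[where B = 1] simp: norm_mult)
  have inth: "integrable M h" "integrable N h'"
    using h by (auto intro!: M.integrable_const_bound[where B = 1] N.integrable_const_bound[where B = 1])
  \<comment> \<open>The conjugate of the hypothesis at \<open>- t\<close>. Real and imaginary parts
    of the weight are combinations of \<open>h\<close> and \<open>cnj h\<close>, so both versions
    are required.\<close>
  have eqc: "(CLINT x|M. cnj (h x) * cis (t * V x)) = (CLINT x|N. cnj (h' x) * cis (t * V' x))" for t
  proof -
    have "(CLINT x|M. cnj (h x) * cis (t * V x)) = cnj (CLINT x|M. h x * cis (- t * V x))"
      unfolding Bochner_Integration.integral_cnj[symmetric] by (simp add: cis_cnj del: Bochner_Integration.integral_cnj)
    also have "\<dots> = (CLINT x|N. cnj (h' x) * cis (t * V' x))"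
      unfolding eqh Bochner_Integration.integral_cnj[symmetric] by (simp add: cis_cnj del: Bochner_Integration.integral_cnj)
    finally show ?thesis .
  qed
  note [simp] = intM intN M.integrable_cis N.integrable_cis
  have re: "of_real (1 + Re z) * w = w + (z * w + cnj z * w) / 2" for z w
    by (simp add: complex_eq_iff field_simps)
  have im: "of_real (1 + Im z) * w = w + (z * w - cnj z * w) / (2 * \<i>)" for z w
  proof -
    have "z * w - cnj z * w = of_real (2 * Im z) * \<i> * w"
      using complex_diff_cnj[of z] by (metis left_diff_distrib)
    then show ?thesis by (simp add: field_simps)
  qed
  have law0: "distr (density M (\<lambda>x. ennreal 1)) borel V = distr (density N (\<lambda>x. ennreal 1)) borel V'"
    by (rule distr_density_eqI_char) (auto simp: eq)
  have lawR: "distr (density M (\<lambda>x. ennreal (1 + Re (h x)))) borel V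
      = distr (density N (\<lambda>x. ennreal (1 + Re (h' x)))) borel V'"
  proof (rule distr_density_eqI_char)
    show "integrable M (\<lambda>x. 1 + Re (h x))" "integrable N (\<lambda>x. 1 + Re (h' x))"
      using inth by auto
    show "(CLINT x|M. complex_of_real (1 + Re (h x)) * cis (t * V x)) =
          (CLINT x|N. complex_of_real (1 + Re (h' x)) * cis (t * V' x))" for t
      unfolding re by (simp add: eq eqh eqc)
  qed (use nn in auto)
  have lawI: "distr (density M (\<lambda>x. ennreal (1 + Im (h x)))) borel V
      = distr (density N (\<lambda>x. ennreal (1 + Im (h' x)))) borel V'"
  proof (rule distr_density_eqI_char)
    show "integrable M (\<lambda>x. 1 + Im (h x))" "integrable N (\<lambda>x. 1 + Im (h' x))"
      using inth by auto
    show "(CLINT x|M. complex_of_real (1 + Im (h x)) * cis (t * V x)) =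
          (CLINT x|N. complex_of_real (1 + Im (h' x)) * cis (t * V' x))" for t
      unfolding im by (simp add: eq eqh eqc)
  qed (use nn in auto)
  \<comment> \<open>Integrability carries over from \<open>M\<close> because \<open>law0\<close>
    gives \<open>V\<close> and \<open>V'\<close> the same law.\<close>
  have gN: "integrable N (\<lambda>x. g (V' x))"
  proof -
    have "integrable (distr M borel V) g" using g by (simp add: integrable_distr_eq)
    then have "integrable (distr N borel V') g" using law0 by (simp add: density_1)
    then show ?thesis by (simp add: integrable_distr_eq)
  qed
  have "(CLINT x|M. of_real (1 + Re (h x)) * g (V x)) = (CLINT x|N. of_real (1 + Re (h' x)) * g (V' x))"
    using arg_cong[OF lawR, of "\<lambda>D. integral\<^sup>L D g"] nn
    by (simp add: integral_distr integral_density scaleR_conv_of_real)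
  moreover have "(CLINT x|M. of_real (1 + Im (h x)) * g (V x)) = (CLINT x|N. of_real (1 + Im (h' x)) * g (V' x))"
    using arg_cong[OF lawI, of "\<lambda>D. integral\<^sup>L D g"] nn
    by (simp add: integral_distr integral_density scaleR_conv_of_real)
  moreover have "(CLINT x|M. g (V x)) = (CLINT x|N. g (V' x))"
    using arg_cong[OF law0, of "\<lambda>D. integral\<^sup>L D g"]
    by (simp add: integral_distr density_1)
  \<comment> \<open>Recovers the complex weight from the three nonnegative ones; the shifts by
    \<open>1\<close> contribute \<open>1 + \<i>\<close>, which is subtracted.\<close>
  moreover have "h x * g (V x) = of_real (1 + Re (h x)) * g (V x)
      + \<i> * (of_real (1 + Im (h x)) * g (V x)) - (1 + \<i>) * g (V x)" for x
    by (simp add: complex_eq_iff algebra_simps)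
  moreover have "h' x * g (V' x) = of_real (1 + Re (h' x)) * g (V' x)
      + \<i> * (of_real (1 + Im (h' x)) * g (V' x)) - (1 + \<i>) * g (V' x)" for x
    by (simp add: complex_eq_iff algebra_simps)
  moreover have "integrable M (\<lambda>x. of_real (f x) * g (V x))"
    if [measurable]: "f \<in> borel_measurable M" and f: "\<And>x. 0 \<le> f x" "\<And>x. f x \<le> 2" for f
    by (rule Bochner_Integration.integrable_bound[OF integrable_mult_right[OF g, of 2]])
       (use f in \<open>auto simp: norm_mult intro!: mult_right_mono\<close>)
  note this[of "\<lambda>x. 1 + Re (h x)"] this[of "\<lambda>x. 1 + Im (h x)"]
  moreover have "integrable N (\<lambda>x. of_real (f x) * g (V' x))"
    if [measurable]: "f \<in> borel_measurable N" and f: "\<And>x. 0 \<le> f x" "\<And>x. f x \<le> 2" for f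
    by (rule Bochner_Integration.integrable_bound[OF integrable_mult_right[OF gN, of 2]])
       (use f in \<open>auto simp: norm_mult intro!: mult_right_mono\<close>)
  note this[of "\<lambda>x. 1 + Re (h' x)"] this[of "\<lambda>x. 1 + Im (h' x)"]
  ultimately show ?thesis using g gN nn le2 by (simp del: of_real_add)
qed

section \<open>Cramer--Wold: from linear combinations to joint laws\<close>

text \<open>Induction on the coordinates: the event that coordinate \<open>i\<close> lies in
  \<open>A i\<close> is absorbed into the measure as a density, and the remaining coordinates keep
  equal characteristic functions under the weighted measures. The measures therefore vary in the
  induction.\<close>

lemma measure_eqI_char:
  fixes X :: "'i \<Rightarrow> 'a \<Rightarrow> real" and Y :: "'i \<Rightarrow> 'b \<Rightarrow> real"
  assumes "finite S" "finite_measure M" "finite_measure N"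
    and "\<And>i. i \<in> S \<Longrightarrow> X i \<in> borel_measurable M" "\<And>i. i \<in> S \<Longrightarrow> Y i \<in> borel_measurable N"
    and "\<And>i. i \<in> S \<Longrightarrow> A i \<in> sets borel"
    and "\<And>a. (CLINT \<omega>|M. cis (\<Sum>i\<in>S. a i * X i \<omega>)) = (CLINT \<omega>|N. cis (\<Sum>i\<in>S. a i * Y i \<omega>))"
  shows "measure M {\<omega>\<in>space M. \<forall>i\<in>S. X i \<omega> \<in> A i} = measure N {\<omega>\<in>space N. \<forall>i\<in>S. Y i \<omega> \<in> A i}"
  using assms
proof (induction S arbitrary: M N rule: finite_induct)
  case empty
  then show ?case by simp
next
  case (insert i S)
  interpret M: finite_measure M by fact
  interpret N: finite_measure N by fact
  have [measurable]: "X j \<in> borel_measurable M" "Y j \<in> borel_measurable N" "A j \<in> sets borel"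
    if "j \<in> S" for j using that insert.prems by auto
  have [measurable]: "X i \<in> borel_measurable M" "Y i \<in> borel_measurable N" "A i \<in> sets borel"
    using insert.prems by auto
  define M' where "M' = density M (\<lambda>\<omega>. ennreal (indicator (A i) (X i \<omega>)))"
  define N' where "N' = density N (\<lambda>\<omega>. ennreal (indicator (A i) (Y i \<omega>)))"
  have "finite_measure (density K (\<lambda>\<omega>. ennreal (indicator (A i) (Z \<omega>))))"
    if K: "finite_measure K" and [measurable]: "Z \<in> borel_measurable K" for K :: "'c measure" and Z
  proof (rule finite_measureI)
    interpret K: finite_measure K by fact
    have "(\<integral>\<^sup>+ \<omega>. ennreal (indicator (A i) (Z \<omega>)) \<partial>K) \<le> (\<integral>\<^sup>+ \<omega>. 1 \<partial>K)"
      by (intro nn_integral_mono) (auto split: split_indicator)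
    also have "\<dots> < \<infinity>" by (simp add: less_top[symmetric])
    finally show "emeasure (density K (\<lambda>\<omega>. ennreal (indicator (A i) (Z \<omega>))))
        (space (density K (\<lambda>\<omega>. ennreal (indicator (A i) (Z \<omega>))))) \<noteq> \<infinity>"
      by (simp add: emeasure_density)
  qed
  note fin = this[OF insert.prems(1), of "X i", folded M'_def] this[OF insert.prems(2), of "Y i", folded N'_def]
  have int_upd: "(\<Sum>j\<in>insert i S. (a(i := t)) j * Z j \<omega>) = (\<Sum>j\<in>S. a j * Z j \<omega>) + t * Z i \<omega>"
    for a t and Z :: "'i \<Rightarrow> 'c \<Rightarrow> real" and \<omega>
  proof -
    have "(\<Sum>j\<in>S. (a(i := t)) j * Z j \<omega>) = (\<Sum>j\<in>S. a j * Z j \<omega>)"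
      using insert.hyps by (intro sum.cong) auto
    then show ?thesis using insert.hyps by simp
  qed
  have eq': "(CLINT \<omega>|M'. cis (\<Sum>j\<in>S. a j * X j \<omega>)) = (CLINT \<omega>|N'. cis (\<Sum>j\<in>S. a j * Y j \<omega>))" for a
  proof -
    have "(CLINT \<omega>|M. cis (\<Sum>j\<in>S. a j * X j \<omega>) * complex_of_real (indicator (A i) (X i \<omega>))) =
          (CLINT \<omega>|N. cis (\<Sum>j\<in>S. a j * Y j \<omega>) * complex_of_real (indicator (A i) (Y i \<omega>)))"
    \<comment> \<open>The variable is coordinate \<open>i\<close>, the test function its indicator,
      and the complex weight is the character of the other coordinates; the product of weight and
      character is a character of the whole family.\<close>
    proof (rule weighted_integral_eqI_char[where g = "\<lambda>x. complex_of_real (indicator (A i) x)"])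
      show "(CLINT \<omega>|M. cis (t * X i \<omega>)) = (CLINT \<omega>|N. cis (t * Y i \<omega>))" for t
        using insert.prems(6)[of "(\<lambda>_. 0)(i := t)"] unfolding int_upd by simp
      show "(CLINT \<omega>|M. cis (\<Sum>j\<in>S. a j * X j \<omega>) * cis (t * X i \<omega>)) =
            (CLINT \<omega>|N. cis (\<Sum>j\<in>S. a j * Y j \<omega>) * cis (t * Y i \<omega>))" for t
        using insert.prems(6)[of "a(i := t)"] unfolding int_upd by (simp add: cis_mult)
      show "integrable M (\<lambda>x. complex_of_real (indicator (A i) (X i x)))"
        by (intro M.integrable_const_bound[where B = 1]) (auto split: split_indicator)
    qed (use M.finite_measure_axioms N.finite_measure_axioms in simp_all)
    then show ?thesis
      unfolding M'_def N'_def
      by (subst (1 2) integral_density) (auto simp: scaleR_conv_of_real mult.commute)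
  qed
  have IH: "measure M' {\<omega>\<in>space M'. \<forall>j\<in>S. X j \<omega> \<in> A j} = measure N' {\<omega>\<in>space N'. \<forall>j\<in>S. Y j \<omega> \<in> A j}"
    by (rule insert.IH) (use fin eq' in \<open>auto simp: M'_def N'_def\<close>)
  have restr: "measure (density K (\<lambda>\<omega>. ennreal (indicator (A i) (Z i \<omega>)))) {\<omega>\<in>space K. \<forall>j\<in>S. Z j \<omega> \<in> A j}
      = measure K {\<omega>\<in>space K. \<forall>j\<in>insert i S. Z j \<omega> \<in> A j}"
    if [measurable]: "\<And>j. j \<in> S \<Longrightarrow> Z j \<in> borel_measurable K" "Z i \<in> borel_measurable K"
    for K :: "'c measure" and Z
  proof -
    have [measurable]: "{\<omega>\<in>space K. \<forall>j\<in>S. Z j \<omega> \<in> A j} \<in> sets K"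
      using insert.hyps(1) by (intro sets.sets_Collect_finite_All) auto
    have [measurable]: "{\<omega>\<in>space K. \<forall>j\<in>insert i S. Z j \<omega> \<in> A j} \<in> sets K"
      using insert.hyps(1) by (intro sets.sets_Collect_finite_All) auto
    show ?thesis
      unfolding measure_def
      by (subst emeasure_density)
         (auto intro!: arg_cong[where f = enn2real] nn_integral_cong split: split_indicator
           simp flip: nn_integral_indicator)
  qed
  show ?case
    using IH insert.prems(4,5) by (simp add: M'_def N'_def restr)
qed

text \<open>Cylinders over finite subsets of \<open>T\<close> generate the product sigma-algebra and
  are stable under intersection, so finitely many coordinates at a time suffice for an arbitrary
  index set.\<close>

lemma distr_PiM_eqI_char:
  fixes X :: "'i \<Rightarrow> 'a \<Rightarrow> real" and Y :: "'i \<Rightarrow> 'b \<Rightarrow> real"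
  assumes fin: "finite_measure M" "finite_measure N"
    and X [measurable]: "\<And>i. i \<in> T \<Longrightarrow> X i \<in> borel_measurable M"
    and Y [measurable]: "\<And>i. i \<in> T \<Longrightarrow> Y i \<in> borel_measurable N"
    and eq: "\<And>F a. finite F \<Longrightarrow> F \<subseteq> T \<Longrightarrow>
      (CLINT \<omega>|M. cis (\<Sum>i\<in>F. a i * X i \<omega>)) = (CLINT \<omega>|N. cis (\<Sum>i\<in>F. a i * Y i \<omega>))"
  shows "distr M (\<Pi>\<^sub>M i\<in>T. borel) (\<lambda>\<omega>. \<lambda>i\<in>T. X i \<omega>) = distr N (\<Pi>\<^sub>M i\<in>T. borel) (\<lambda>\<omega>. \<lambda>i\<in>T. Y i \<omega>)"
proof (rule measure_eqI_PiM_infinite)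
  interpret M: finite_measure M by fact
  interpret N: finite_measure N by fact
  show "finite_measure (distr M (\<Pi>\<^sub>M i\<in>T. borel) (\<lambda>\<omega>. \<lambda>i\<in>T. X i \<omega>))"
    by (intro M.finite_measure_distr) measurable
  fix A :: "'i \<Rightarrow> real set" and J
  assume J: "finite J" "J \<subseteq> T" and A: "\<And>i. i \<in> J \<Longrightarrow> A i \<in> sets borel"
  have *: "emeasure (distr K (\<Pi>\<^sub>M i\<in>T. borel) (\<lambda>\<omega>. \<lambda>i\<in>T. Z i \<omega>)) (prod_emb T (\<lambda>_. borel) J (Pi\<^sub>E J A))
      = emeasure K {\<omega>\<in>space K. \<forall>i\<in>J. Z i \<omega> \<in> A i}"
    if [measurable]: "\<And>i. i \<in> T \<Longrightarrow> Z i \<in> borel_measurable K" for K :: "'c measure" and Z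
  proof -
    have "(\<lambda>\<omega>. \<lambda>i\<in>T. Z i \<omega>) -` prod_emb T (\<lambda>_. borel) J (Pi\<^sub>E J A) \<inter> space K
        = {\<omega>\<in>space K. \<forall>i\<in>J. Z i \<omega> \<in> A i}"
      using J by (auto simp: prod_emb_def PiE_iff Int_absorb2 subset_eq)
    then show ?thesis
      using J A by (subst emeasure_distr) auto
  qed
  have "measure M {\<omega>\<in>space M. \<forall>i\<in>J. X i \<omega> \<in> A i} = measure N {\<omega>\<in>space N. \<forall>i\<in>J. Y i \<omega> \<in> A i}"
    using J A X Y by (intro measure_eqI_char fin eq) auto
  then show "emeasure (distr M (\<Pi>\<^sub>M i\<in>T. borel) (\<lambda>\<omega>. \<lambda>i\<in>T. X i \<omega>)) (prod_emb T (\<lambda>_. borel) J (Pi\<^sub>E J A))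
    = emeasure (distr N (\<Pi>\<^sub>M i\<in>T. borel) (\<lambda>\<omega>. \<lambda>i\<in>T. Y i \<omega>)) (prod_emb T (\<lambda>_. borel) J (Pi\<^sub>E J A))"
    using X Y by (simp add: * M.emeasure_eq_measure N.emeasure_eq_measure)
qed auto

section \<open>Tilting a Gaussian law\<close>

lemma sets_normal_law [simp, measurable_cong]: "sets (normal_law \<mu> \<sigma>) = sets borel"
  by (simp add: normal_law_def)

lemma prob_space_normal_law: "0 \<le> \<sigma> \<Longrightarrow> prob_space (normal_law \<mu> \<sigma>)"
  by (auto simp: normal_law_def intro!: prob_space_return prob_space_normal_density)

lemma char_normal_law:
  assumes "0 \<le> \<sigma>"
  shows "(CLINT x|normal_law \<mu> \<sigma>. cis (t * x)) = cis (t * \<mu>) * complex_of_real (exp (- (t * \<sigma>)\<^sup>2 / 2))"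
proof (cases "\<sigma> = 0")
  case True
  then show ?thesis by (simp add: normal_law_def integral_return)
next
  case False
  then have pos: "0 < \<sigma>" using assms by simp
  interpret std: real_distribution std_normal_distribution by (rule real_dist_normal_dist)
  have "distributed std_normal_distribution lborel (\<lambda>x. x) (normal_density 0 1)"
    by (simp add: distributed_def distr_id2)
  from std.normal_density_affine[OF this, of \<sigma> \<mu>] pos
  have "distr std_normal_distribution lborel (\<lambda>x. \<mu> + \<sigma> * x) = normal_law \<mu> \<sigma>"
    by (simp add: distributed_def normal_law_def)
  then have "(CLINT x|normal_law \<mu> \<sigma>. cis (t * x)) =
      (CLINT x|distr std_normal_distribution lborel (\<lambda>x. \<mu> + \<sigma> * x). cis (t * x))" by simp
  also have "\<dots> = (CLINT x|std_normal_distribution. cis (t * \<mu>) * cis (t * \<sigma> * x))"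
    by (subst integral_distr) (auto simp: cis_mult algebra_simps)
  also have "\<dots> = cis (t * \<mu>) * char std_normal_distribution (t * \<sigma>)"
    by (simp add: char_def cis_conv_exp)
  finally show ?thesis by (simp add: char_std_normal_distribution)
qed

text \<open>Removing from \<open>L\<close> its projection \<open>(c / s) Z\<close> leaves a variable uncorrelated with, hence
  independent of, \<open>Z\<close>; for \<open>Z\<close> alone the tilt by \<open>exp (z - s / 2)\<close> turns the \<open>N(0, s)\<close> density
  into the \<open>N(s, s)\<close> density.\<close>

lemma (in prob_space) gaussian_tilt:
  assumes [measurable]: "L \<in> borel_measurable M" "Z \<in> borel_measurable M" and "0 \<le> s"
    and char: "\<And>a b. (CLINT \<omega>|M. cis (a * L \<omega> + b * Z \<omega>)) = complex_of_real (exp (- (a\<^sup>2 * v + 2 * a * b * c + b\<^sup>2 * s) / 2))"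
  shows "integrable M (\<lambda>\<omega>. exp (Z \<omega> - s / 2))"
    and "(CLINT \<omega>|M. complex_of_real (exp (Z \<omega> - s / 2)) * cis (L \<omega>)) = cis c * complex_of_real (exp (- v / 2))"
proof -
  have lawZ: "distr M borel Z = normal_law 0 (sqrt s)"
  proof (rule finite_measure_eqI_char)
    show "finite_measure (distr M borel Z)" by (rule finite_measure_distr) simp
    show "finite_measure (normal_law 0 (sqrt s))"
      using prob_space_normal_law[of "sqrt s"] \<open>0 \<le> s\<close> by (simp add: prob_space_def)
    show "(CLINT x|distr M borel Z. cis (t * x)) = (CLINT x|normal_law 0 (sqrt s). cis (t * x))" for t
      using char[of 0 t] \<open>0 \<le> s\<close> by (simp add: char_normal_law integral_distr power_mult_distrib)
  qed auto
  have "integrable M (\<lambda>\<omega>. exp (Z \<omega> - s / 2)) \<and>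
      (CLINT \<omega>|M. complex_of_real (exp (Z \<omega> - s / 2)) * cis (L \<omega>)) = cis c * complex_of_real (exp (- v / 2))"
  proof (cases "s = 0")
    case True
    have "distr M borel Z = return borel 0"
      using lawZ True by (simp add: normal_law_def)
    moreover have "AE x in return borel (0::real). x = 0"
      by (subst AE_return) auto
    ultimately have "AE x in distr M borel Z. x = 0" by (simp only:)
    then have Z: "AE \<omega> in M. Z \<omega> = 0" by (rule AE_distrD[rotated]) simp
    have cisL: "(CLINT \<omega>|M. cis (L \<omega> + b * Z \<omega>)) = (CLINT \<omega>|M. cis (L \<omega>))" for b
      using Z by (intro integral_cong_AE) auto
    \<comment> \<open>Since \<open>Z\<close> vanishes almost surely, the joint characteristic
      function takes the same value at \<open>(1, 1)\<close> and \<open>(1, 0)\<close>; comparing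
      exponents forces \<open>c = 0\<close>, and the tilt is trivial.\<close>
    have "complex_of_real (exp (- (v + 2 * c) / 2)) = complex_of_real (exp (- v / 2))"
      using char[of 1 0] char[of 1 1] cisL[of 1] True by simp
    then have "exp (- (v + 2 * c) / 2) = exp (- v / 2)"
      by (simp only: of_real_eq_iff)
    then have c: "c = 0" by simp
    have "(CLINT \<omega>|M. complex_of_real (exp (Z \<omega> - s / 2)) * cis (L \<omega>)) = (CLINT \<omega>|M. cis (L \<omega>))"
      using Z True by (intro integral_cong_AE) auto
    moreover have "integrable M (\<lambda>\<omega>. exp (Z \<omega> - s / 2))"
      using Z True by (subst integrable_cong_AE[where g = "\<lambda>_. 1"]) auto
    ultimately show ?thesis using c char[of 1 0] by simp
  next
    case False
    then have s: "0 < s" using \<open>0 \<le> s\<close> by simp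
    \<comment> \<open>\<open>k\<close> is the regression coefficient of \<open>L\<close> on
      \<open>Z\<close> and \<open>v'\<close> the residual variance. The function \<open>g\<close>
      collects all that depends on \<open>Z\<close>: the tilt and the part of
      \<open>cis (L \<omega>)\<close> explained by \<open>Z\<close>.\<close>
    define k where "k = c / s"
    define v' where "v' = v - c\<^sup>2 / s"
    define g where "g = (\<lambda>z. complex_of_real (exp (z - s / 2)) * cis (k * z))"
    have [measurable]: "g \<in> borel_measurable borel" unfolding g_def by measurable
    have law: "distr M borel Z = density lborel (\<lambda>x. ennreal (normal_density 0 (sqrt s) x))"
      using lawZ s by (simp add: normal_law_def)
    have dens: "normal_density 0 (sqrt s) z * exp (z - s / 2) = normal_density s (sqrt s) z" for z
    proof -
      have "- (z\<^sup>2) / (2 * s) + (z - s / 2) = - ((z - s)\<^sup>2) / (2 * s)"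
        using s by (simp add: field_simps power2_eq_square)
      then show ?thesis using s by (simp add: normal_density_def flip: exp_add)
    qed
    have "integrable (distr M borel Z) (\<lambda>z. exp (z - s / 2))"
      unfolding law using s by (simp add: integrable_density dens)
    then have int: "integrable M (\<lambda>\<omega>. exp (Z \<omega> - s / 2))" by (simp add: integrable_distr_eq)
    then have intg: "integrable M (\<lambda>\<omega>. g (Z \<omega>))"
      by (rule Bochner_Integration.integrable_bound) (auto simp: g_def norm_mult)
    have "(CLINT \<omega>|M. g (Z \<omega>)) = (CLINT z|distr M borel Z. g z)" by (simp add: integral_distr)
    also have "\<dots> = (CLINT z|lborel. normal_density s (sqrt s) z *\<^sub>R cis (k * z))"
      unfolding law by (subst integral_density)
        (auto simp: g_def scaleR_conv_of_real mult.assoc[symmetric] simp flip: of_real_mult dens)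
    also have "\<dots> = (CLINT z|normal_law s (sqrt s). cis (k * z))"
      using s by (subst integral_density[symmetric]) (auto simp: normal_law_def)
    also have "\<dots> = cis c * complex_of_real (exp (- (c\<^sup>2 / s) / 2))"
    proof -
      have "k * s = c" "(k * sqrt s)\<^sup>2 = c\<^sup>2 / s"
        using s by (simp_all add: k_def power_mult_distrib power_divide) (simp add: power2_eq_square)
      then show ?thesis using s by (simp only: char_normal_law real_sqrt_ge_zero less_imp_le)
    qed
    finally have Eg: "(CLINT \<omega>|M. g (Z \<omega>)) = cis c * complex_of_real (exp (- (c\<^sup>2 / s) / 2))" .
    have char': "(CLINT \<omega>|M. cis (a * (L \<omega> - k * Z \<omega>) + t * Z \<omega>)) = complex_of_real (exp (- (a\<^sup>2 * v') / 2) * exp (- (t\<^sup>2 * s) / 2))" for a t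
    proof -
      have "a * (L \<omega> - k * Z \<omega>) + t * Z \<omega> = a * L \<omega> + (t - a * k) * Z \<omega>" for \<omega>
        by (simp add: algebra_simps)
      moreover have "a\<^sup>2 * v + 2 * a * (t - a * k) * c + (t - a * k)\<^sup>2 * s = a\<^sup>2 * v' + t\<^sup>2 * s"
        using s by (simp add: k_def v'_def field_simps power2_eq_square)
      ultimately show ?thesis
        using char[of a "t - a * k"] by (simp flip: exp_add of_real_mult add: add_divide_distrib)
    qed
    \<comment> \<open>A characteristic function is bounded by \<open>1\<close>, so the residual
      variance is nonnegative and the constant weight \<open>exp (- v' / 2)\<close> meets the norm
      bound of \<open>weighted_integral_eqI_char\<close>.\<close>
    have "norm (CLINT \<omega>|M. cis (L \<omega> - k * Z \<omega>)) \<le> (\<integral>\<omega>. 1 \<partial>M)"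
      by (rule order_trans[OF integral_norm_bound]) simp
    then have "0 \<le> v'"
      using char'[of 1 0] by (simp add: prob_space)
    \<comment> \<open>Independence in integrated form: against functions of \<open>Z\<close>, the
      character of the residual may be replaced by its mean. It is enough to check this against
      characters of \<open>Z\<close>, where \<open>char'\<close> factorises.\<close>
    have "(CLINT \<omega>|M. cis (L \<omega> - k * Z \<omega>) * g (Z \<omega>)) = (CLINT \<omega>|M. complex_of_real (exp (- v' / 2)) * g (Z \<omega>))"
    proof (rule weighted_integral_eqI_char)
      show "(CLINT \<omega>|M. cis (L \<omega> - k * Z \<omega>) * cis (t * Z \<omega>)) =
          (CLINT \<omega>|M. complex_of_real (exp (- v' / 2)) * cis (t * Z \<omega>))" for t
        using char'[of 1 t] char'[of 0 t] by (simp add: cis_mult)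
    qed (use \<open>0 \<le> v'\<close> intg finite_measure_axioms in auto)
    moreover have "cis (L \<omega> - k * Z \<omega>) * g (Z \<omega>) = complex_of_real (exp (Z \<omega> - s / 2)) * cis (L \<omega>)" for \<omega>
      by (simp add: g_def cis_mult mult.left_commute)
    moreover have "exp (- v' / 2) * exp (- (c\<^sup>2 / s) / 2) = exp (- v / 2)"
      by (simp add: v'_def diff_divide_distrib flip: exp_add)
    ultimately show ?thesis
      using int Eg by (simp add: mult.left_commute flip: of_real_mult)
  qed
  then show "integrable M (\<lambda>\<omega>. exp (Z \<omega> - s / 2))"
    and "(CLINT \<omega>|M. complex_of_real (exp (Z \<omega> - s / 2)) * cis (L \<omega>)) = cis c * complex_of_real (exp (- v / 2))" by auto
qed

section \<open>Likelihood ratios of Gaussian experiments\<close>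

text \<open>Encoded through characteristic functions of finite linear combinations: this covers
  degenerate laws and is the form that \<open>distr_PiM_eqI_char\<close> compares.\<close>

definition gaussian_process ::
  "'a measure \<Rightarrow> 't set \<Rightarrow> ('t \<Rightarrow> 'a \<Rightarrow> real) \<Rightarrow> ('t \<Rightarrow> real) \<Rightarrow> ('t \<Rightarrow> 't \<Rightarrow> real) \<Rightarrow> bool" where
  "gaussian_process M T X m K \<longleftrightarrow>
     (\<forall>t\<in>T. X t \<in> borel_measurable M) \<and>
     (\<forall>F a. finite F \<and> F \<subseteq> T \<longrightarrow>
        (CLINT \<omega>|M. cis (\<Sum>t\<in>F. a t * X t \<omega>)) =
          cis (\<Sum>t\<in>F. a t * m t) * complex_of_real (exp (- (\<Sum>s\<in>F. \<Sum>t\<in>F. a s * a t * K s t) / 2)))"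

text \<open>The covariance of two linear combinations of coordinates, with coefficients
  \<open>a\<close> on \<open>F\<close> and \<open>b\<close> on \<open>G\<close>, for a process with
  covariance kernel \<open>K\<close>.\<close>

definition cov_form :: "('t \<Rightarrow> 't \<Rightarrow> real) \<Rightarrow> 't set \<Rightarrow> 't set \<Rightarrow> ('t \<Rightarrow> real) \<Rightarrow> ('t \<Rightarrow> real) \<Rightarrow> real" where
  "cov_form K F G a b = (\<Sum>s\<in>F. \<Sum>t\<in>G. a s * b t * K s t)"

text \<open>The supports \<open>G i\<close> may overlap, while \<open>gaussian_process\<close>
  speaks of one combination over one finite set. The coefficients are therefore collected on the
  union, extended by zero, and the resulting quadratic form is expanded again by
  bilinearity.\<close>

lemma gaussian_process_combination:
  assumes X: "gaussian_process M T X m K" and "finite I" and G: "\<And>i. i \<in> I \<Longrightarrow> finite (G i) \<and> G i \<subseteq> T"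
  shows "(CLINT \<omega>|M. cis (\<Sum>i\<in>I. \<alpha> i * (\<Sum>s\<in>G i. c i s * X s \<omega>))) =
    cis (\<Sum>i\<in>I. \<alpha> i * (\<Sum>s\<in>G i. c i s * m s)) *
    complex_of_real (exp (- (\<Sum>i\<in>I. \<Sum>j\<in>I. \<alpha> i * \<alpha> j * cov_form K (G i) (G j) (c i) (c j)) / 2))"
proof -
  define U where "U = (\<Union>i\<in>I. G i)"
  define A where "A = (\<lambda>s. \<Sum>i\<in>I. \<alpha> i * (if s \<in> G i then c i s else 0))"
  have U: "finite U" "U \<subseteq> T" using G \<open>finite I\<close> by (auto simp: U_def)
  have lin: "(\<Sum>s\<in>U. A s * f s) = (\<Sum>i\<in>I. \<alpha> i * (\<Sum>s\<in>G i. c i s * f s))" for f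
  proof -
    have "(\<Sum>s\<in>U. A s * f s) = (\<Sum>i\<in>I. \<alpha> i * (\<Sum>s\<in>U. (if s \<in> G i then c i s else 0) * f s))"
      unfolding A_def sum_distrib_right sum_distrib_left by (subst sum.swap) (simp add: mult.assoc)
    also have "\<dots> = (\<Sum>i\<in>I. \<alpha> i * (\<Sum>s\<in>G i. c i s * f s))"
    proof (rule sum.cong[OF refl])
      fix i assume "i \<in> I"
      then have "(\<Sum>s\<in>U. (if s \<in> G i then c i s else 0) * f s) = (\<Sum>s\<in>G i. c i s * f s)"
        using U(1) by (intro sum.mono_neutral_cong_right) (auto simp: U_def)
      then show "\<alpha> i * (\<Sum>s\<in>U. (if s \<in> G i then c i s else 0) * f s) = \<alpha> i * (\<Sum>s\<in>G i. c i s * f s)"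
        by simp
    qed
    finally show ?thesis .
  qed
  have "(\<Sum>s\<in>U. \<Sum>t\<in>U. A s * A t * K s t) = (\<Sum>s\<in>U. A s * (\<Sum>t\<in>U. A t * K s t))"
    by (simp add: sum_distrib_left mult.assoc)
  also have "\<dots> = (\<Sum>i\<in>I. \<alpha> i * (\<Sum>s\<in>G i. c i s * (\<Sum>j\<in>I. \<alpha> j * (\<Sum>t\<in>G j. c j t * K s t))))"
    unfolding lin ..
  also have "\<dots> = (\<Sum>i\<in>I. \<Sum>j\<in>I. \<alpha> i * \<alpha> j * cov_form K (G i) (G j) (c i) (c j))"
    unfolding cov_form_def sum_distrib_left
    by (intro sum.cong refl, subst sum.swap) (simp add: ac_simps)
  finally show ?thesis
    using X U unfolding gaussian_process_def by (simp add: lin[symmetric])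
qed

lemma gaussian_process_measurable_sum:
  "gaussian_process M T X m K \<Longrightarrow> F \<subseteq> T \<Longrightarrow> (\<lambda>\<omega>. \<Sum>s\<in>F. a s * X s \<omega>) \<in> borel_measurable M"
  unfolding gaussian_process_def by (intro borel_measurable_sum borel_measurable_times) auto

text \<open>The case of two combinations, indexed by \<open>bool\<close>. Symmetry of
  \<open>K\<close> merges the two cross terms, which gives the quadratic form expected by
  \<open>gaussian_tilt\<close>.\<close>

lemma gaussian_process_combination2:
  assumes X: "gaussian_process M T X m K" and F: "finite F" "F \<subseteq> T" and G: "finite G" "G \<subseteq> T"
    and K: "\<And>s t. s \<in> T \<Longrightarrow> t \<in> T \<Longrightarrow> K s t = K t s"
  shows "(CLINT \<omega>|M. cis (\<alpha> * (\<Sum>s\<in>F. a s * X s \<omega>) + \<beta> * (\<Sum>s\<in>G. b s * X s \<omega>))) =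
    cis (\<alpha> * (\<Sum>s\<in>F. a s * m s) + \<beta> * (\<Sum>s\<in>G. b s * m s)) *
    complex_of_real (exp (- (\<alpha>\<^sup>2 * cov_form K F F a a + 2 * \<alpha> * \<beta> * cov_form K F G a b
      + \<beta>\<^sup>2 * cov_form K G G b b) / 2))"
proof -
  have sym: "cov_form K G F b a = cov_form K F G a b"
    unfolding cov_form_def using F G K
    by (subst sum.swap) (auto intro!: sum.cong simp: subset_eq)
  show ?thesis
    using gaussian_process_combination[OF X, of "UNIV :: bool set" "\<lambda>i. if i then F else G"
        "\<lambda>i. if i then \<alpha> else \<beta>" "\<lambda>i. if i then a else b"] F G
    by (simp add: UNIV_bool sym algebra_simps power2_eq_square)
qed

text \<open>Positivity of the kernel is not part of \<open>gaussian_process\<close>; it follows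
  because the characteristic function, of modulus \<open>exp (- v / 2)\<close> with \<open>v\<close>
  the form in question, is at most \<open>1\<close> in modulus.\<close>

lemma (in prob_space) gaussian_process_variance_nonneg:
  assumes X: "gaussian_process M T X m K" and G: "finite G" "G \<subseteq> T"
  shows "0 \<le> cov_form K G G c c"
proof -
  have "norm (CLINT \<omega>|M. cis (\<Sum>s\<in>G. c s * X s \<omega>)) \<le> (\<integral>\<omega>. 1 \<partial>M)"
    by (rule order_trans[OF integral_norm_bound]) simp
  then show ?thesis
    using X G by (simp add: gaussian_process_def prob_space norm_mult cov_form_def)
qed

text \<open>A measure with a density is its own absolutely continuous part, with zero singular part.
  The density is positive and finite, so \<open>ln_ennreal\<close> falls into its real case; the
  equality holds almost everywhere because \<open>RN_deriv\<close> is determined only up to null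
  sets.\<close>

lemma log_likelihood_ratio_density:
  assumes "sigma_finite_measure Q"
    and f [measurable]: "f \<in> borel_measurable Q" and P: "P = density Q (\<lambda>\<omega>. ennreal (exp (f \<omega>)))"
  shows "AE \<omega> in Q. log_likelihood_ratio P Q \<omega> = ereal (f \<omega>)"
proof -
  interpret sigma_finite_measure Q by fact
  have sets: "sets P = sets Q" by (simp add: P)
  have ac: "is_ac_part P Q P"
    unfolding is_ac_part_def singular_measures_def
  proof (intro conjI exI[of _ "null_measure P"] bexI[of _ "{}"])
    show "absolutely_continuous Q P"
      unfolding P by (rule absolutely_continuousI_density) measurable
  qed (auto simp: emeasure_null_measure)
  then have "ac_part P Q = P"
    unfolding ac_part_def using is_ac_part_unique[OF sets] by blast
  moreover have "AE \<omega> in Q. ennreal (exp (f \<omega>)) = RN_deriv Q P \<omega>"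
    using P by (intro RN_deriv_unique) auto
  ultimately show ?thesis
    by (auto simp: log_likelihood_ratio_def ln_ennreal_def elim!: eventually_mono)
       (metis enn2real_ennreal exp_ge_zero ln_exp ennreal_neq_top exp_not_eq_zero ennreal_eq_0_iff not_exp_le_zero)+
qed

section \<open>Abstract Gaussian experiments with a common covariance kernel\<close>

text \<open>The mean under \<open>\<theta>\<close> is a Cameron--Martin shift: at each
  \<open>t\<close> it is the covariance of \<open>X t\<close> with the finite combination of
  coordinates that has coefficients \<open>c \<theta>\<close> on \<open>G \<theta>\<close>. This
  combination, the \<open>score\<close>, is the variable that tilts the base measure into
  \<open>E \<theta>\<close>.\<close>

locale gaussian_experiment =
  fixes E :: "'p \<Rightarrow> 'a measure" and T :: "'t set" and X :: "'t \<Rightarrow> 'a \<Rightarrow> real"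
    and K :: "'t \<Rightarrow> 't \<Rightarrow> real" and G :: "'p \<Rightarrow> 't set" and c :: "'p \<Rightarrow> 't \<Rightarrow> real" and \<theta>\<^sub>0 :: 'p
  assumes observing: "experiment_observing E T X"
    and process: "gaussian_process (E \<theta>) T X (\<lambda>t. \<Sum>s\<in>G \<theta>. c \<theta> s * K t s) K"
    and finite_G: "finite (G \<theta>)" and G_subset: "G \<theta> \<subseteq> T"
    and centred: "t \<in> T \<Longrightarrow> (\<Sum>s\<in>G \<theta>\<^sub>0. c \<theta>\<^sub>0 s * K t s) = 0"
    and K_sym: "s \<in> T \<Longrightarrow> t \<in> T \<Longrightarrow> K s t = K t s"
begin

definition score :: "'p \<Rightarrow> 'a \<Rightarrow> real" where
  "score \<theta> \<omega> = (\<Sum>s\<in>G \<theta>. c \<theta> s * X s \<omega>)"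

definition score_cov :: "'p \<Rightarrow> 'p \<Rightarrow> real" where
  "score_cov \<theta> \<theta>' = cov_form K (G \<theta>) (G \<theta>') (c \<theta>) (c \<theta>')"

lemma prob_space_E: "prob_space (E \<theta>)"
  using observing by (simp add: experiment_observing_def)

lemma sets_E: "sets (E \<theta>) = sets (E \<theta>')"
  using observing unfolding experiment_observing_def by metis

lemma measurable_X: "t \<in> T \<Longrightarrow> X t \<in> borel_measurable (E \<theta>)"
  using process unfolding gaussian_process_def by blast

lemma measurable_score: "score \<theta> \<in> borel_measurable (E \<theta>')"
  unfolding score_def by (rule gaussian_process_measurable_sum[OF process G_subset])

lemma process_null: "gaussian_process (E \<theta>\<^sub>0) T X (\<lambda>_. 0) K"
proof -
  have "(\<Sum>t\<in>F. a t * (\<Sum>s\<in>G \<theta>\<^sub>0. c \<theta>\<^sub>0 s * K t s)) = 0" if "F \<subseteq> T" for F a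
    using that centred by (intro sum.neutral) auto
  then show ?thesis using process[of \<theta>\<^sub>0] by (simp add: gaussian_process_def)
qed

text \<open>The sigma-algebra is generated by the observation, so every event is the preimage of a
  measurable set of paths and its probability is read off from the law of the path.\<close>

lemma experiment_measure_eqI:
  assumes "sets Q = sets (E \<theta>)"
    and "distr Q (\<Pi>\<^sub>M t\<in>T. borel) (\<lambda>\<omega>. \<lambda>t\<in>T. X t \<omega>) = distr (E \<theta>) (\<Pi>\<^sub>M t\<in>T. borel) (\<lambda>\<omega>. \<lambda>t\<in>T. X t \<omega>)"
  shows "Q = E \<theta>"
proof (rule measure_eqI)
  fix A assume A: "A \<in> sets Q"
  obtain \<Omega> where \<Omega>: "sets (E \<theta>) = sets (vimage_algebra \<Omega> (\<lambda>\<omega>. \<lambda>t\<in>T. X t \<omega>) (\<Pi>\<^sub>M t\<in>T. borel))"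
    using observing by (auto simp: experiment_observing_def)
  have sp: "space (E \<theta>) = \<Omega>" "space Q = \<Omega>"
    using sets_eq_imp_space_eq[OF \<Omega>] sets_eq_imp_space_eq[OF assms(1)] by auto
  obtain B where B: "B \<in> sets (\<Pi>\<^sub>M t\<in>T. borel)" "A = (\<lambda>\<omega>. \<lambda>t\<in>T. X t \<omega>) -` B \<inter> \<Omega>"
    using A assms(1) \<Omega> by (subst (asm) sets_vimage_algebra2) (auto simp: space_PiM)
  have meas: "(\<lambda>\<omega>. \<lambda>t\<in>T. X t \<omega>) \<in> measurable (E \<theta>) (\<Pi>\<^sub>M t\<in>T. borel)"
    by (intro measurable_restrict measurable_X)
  then have "(\<lambda>\<omega>. \<lambda>t\<in>T. X t \<omega>) \<in> measurable Q (\<Pi>\<^sub>M t\<in>T. borel)"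
    using assms(1) by (simp cong: measurable_cong_sets)
  then show "emeasure Q A = emeasure (E \<theta>) A"
    using arg_cong[OF assms(2), of "\<lambda>D. emeasure D B"] B meas by (simp add: emeasure_distr sp)
qed fact

text \<open>In \<open>gaussian_tilt\<close>, \<open>L\<close> is a combination of coordinates and
  \<open>Z\<close> is the score; the constant \<open>c\<close> there is their covariance, which is
  precisely the mean of the combination required by \<open>process\<close>.\<close>

lemma density_score:
  "E \<theta> = density (E \<theta>\<^sub>0) (\<lambda>\<omega>. ennreal (exp (score \<theta> \<omega> - score_cov \<theta> \<theta> / 2)))"
proof -
  interpret P0: prob_space "E \<theta>\<^sub>0" by (rule prob_space_E)
  note [measurable] = measurable_X measurable_score
  define Q where "Q = density (E \<theta>\<^sub>0) (\<lambda>\<omega>. ennreal (exp (score \<theta> \<omega> - score_cov \<theta> \<theta> / 2)))"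
  have nn: "0 \<le> score_cov \<theta> \<theta>"
    unfolding score_cov_def by (rule P0.gaussian_process_variance_nonneg[OF process finite_G G_subset])
  have tilt: "integrable (E \<theta>\<^sub>0) (\<lambda>\<omega>. exp (score \<theta> \<omega> - score_cov \<theta> \<theta> / 2))"
    "(CLINT \<omega>|E \<theta>\<^sub>0. complex_of_real (exp (score \<theta> \<omega> - score_cov \<theta> \<theta> / 2)) * cis (\<Sum>t\<in>F. a t * X t \<omega>)) =
      cis (cov_form K F (G \<theta>) a (c \<theta>)) * complex_of_real (exp (- cov_form K F F a a / 2))"
    if F: "finite F" "F \<subseteq> T" for F a
  proof -
    have "(CLINT \<omega>|E \<theta>\<^sub>0. cis (\<alpha> * (\<Sum>t\<in>F. a t * X t \<omega>) + \<beta> * score \<theta> \<omega>)) =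
      complex_of_real (exp (- (\<alpha>\<^sup>2 * cov_form K F F a a + 2 * \<alpha> * \<beta> * cov_form K F (G \<theta>) a (c \<theta>)
        + \<beta>\<^sup>2 * score_cov \<theta> \<theta>) / 2))" for \<alpha> \<beta>
      using gaussian_process_combination2[OF process_null F finite_G G_subset K_sym]
      by (simp add: score_def score_cov_def)
    from P0.gaussian_tilt[OF _ _ nn this] show
      "integrable (E \<theta>\<^sub>0) (\<lambda>\<omega>. exp (score \<theta> \<omega> - score_cov \<theta> \<theta> / 2))"
      "(CLINT \<omega>|E \<theta>\<^sub>0. complex_of_real (exp (score \<theta> \<omega> - score_cov \<theta> \<theta> / 2)) * cis (\<Sum>t\<in>F. a t * X t \<omega>)) =
        cis (cov_form K F (G \<theta>) a (c \<theta>)) * complex_of_real (exp (- cov_form K F F a a / 2))"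
      using F by (auto intro!: gaussian_process_measurable_sum[OF process_null])
  qed
  have "distr Q (\<Pi>\<^sub>M t\<in>T. borel) (\<lambda>\<omega>. \<lambda>t\<in>T. X t \<omega>) = distr (E \<theta>) (\<Pi>\<^sub>M t\<in>T. borel) (\<lambda>\<omega>. \<lambda>t\<in>T. X t \<omega>)"
  proof (rule distr_PiM_eqI_char)
    show "finite_measure Q"
      using tilt(1)[of "{}"] by (auto intro!: finite_measureI simp: Q_def emeasure_density nn_integral_eq_integral)
    show "finite_measure (E \<theta>)" using prob_space_E by (simp add: prob_space_def)
    fix F and a :: "'t \<Rightarrow> real" assume F: "finite F" "F \<subseteq> T"
    have [measurable]: "(\<lambda>\<omega>. \<Sum>t\<in>F. a t * X t \<omega>) \<in> borel_measurable (E \<theta>\<^sub>0)"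
      using F by (intro gaussian_process_measurable_sum[OF process_null])
    have "(CLINT \<omega>|Q. cis (\<Sum>t\<in>F. a t * X t \<omega>)) =
      cis (cov_form K F (G \<theta>) a (c \<theta>)) * complex_of_real (exp (- cov_form K F F a a / 2))"
      unfolding Q_def using tilt(2)[OF F, of a]
      by (subst integral_density) (auto simp: scaleR_conv_of_real)
    also have "\<dots> = (CLINT \<omega>|E \<theta>. cis (\<Sum>t\<in>F. a t * X t \<omega>))"
      using process[of \<theta>] F
      by (simp add: gaussian_process_def cov_form_def sum_distrib_left mult.assoc)
    finally show "(CLINT \<omega>|Q. cis (\<Sum>t\<in>F. a t * X t \<omega>)) = (CLINT \<omega>|E \<theta>. cis (\<Sum>t\<in>F. a t * X t \<omega>))" .
  qed (auto simp: Q_def)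
  moreover have "sets Q = sets (E \<theta>)" using sets_E by (simp add: Q_def)
  ultimately show ?thesis using experiment_measure_eqI unfolding Q_def by metis
qed

lemma log_likelihood_ratio_eq:
  "AE \<omega> in E \<theta>\<^sub>0. log_likelihood_ratio (E \<theta>) (E \<theta>\<^sub>0) \<omega> = ereal (score \<theta> \<omega> - score_cov \<theta> \<theta> / 2)"
proof (rule log_likelihood_ratio_density)
  show "sigma_finite_measure (E \<theta>\<^sub>0)"
    using prob_space_E by (auto simp: prob_space_def finite_measure_def)
  show "(\<lambda>\<omega>. score \<theta> \<omega> - score_cov \<theta> \<theta> / 2) \<in> borel_measurable (E \<theta>\<^sub>0)"
    using measurable_score by measurable
qed (rule density_score)

text \<open>The right-hand side depends on the experiment only through \<open>score_cov\<close>; the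
  comparison of two experiments rests on this.\<close>

lemma char_scores:
  "(CLINT \<omega>|E \<theta>\<^sub>0. cis (\<Sum>i\<in>I. a i * (score (\<theta> i) \<omega> - score_cov (\<theta> i) (\<theta> i) / 2))) =
    cis (- (\<Sum>i\<in>I. a i * score_cov (\<theta> i) (\<theta> i) / 2)) *
    complex_of_real (exp (- (\<Sum>i\<in>I. \<Sum>j\<in>I. a i * a j * score_cov (\<theta> i) (\<theta> j)) / 2))"
  if "finite I" for I :: "nat set"
proof -
  have "(CLINT \<omega>|E \<theta>\<^sub>0. cis (\<Sum>i\<in>I. a i * (score (\<theta> i) \<omega> - score_cov (\<theta> i) (\<theta> i) / 2))) =
    (CLINT \<omega>|E \<theta>\<^sub>0. cis (- (\<Sum>i\<in>I. a i * score_cov (\<theta> i) (\<theta> i) / 2)) * cis (\<Sum>i\<in>I. a i * score (\<theta> i) \<omega>))"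
    by (simp add: cis_mult algebra_simps sum_subtractf)
  then show ?thesis
    using gaussian_process_combination[OF process_null that, of "\<lambda>i. G (\<theta> i)" a "\<lambda>i. c (\<theta> i)"]
      finite_G G_subset
    by (simp add: score_def score_cov_def)
qed

text \<open>The ratios are extended real, whereas the uniqueness results concern real variables.
  Their joint law is written as the image of the law of a real vector under the coordinatewise
  embedding.\<close>

lemma distr_log_likelihood_ratios:
  "distr (E \<theta>\<^sub>0) (\<Pi>\<^sub>M i\<in>I. borel) (\<lambda>\<omega>. \<lambda>i\<in>I. log_likelihood_ratio (E (\<theta> i)) (E \<theta>\<^sub>0) \<omega>) =
    distr (distr (E \<theta>\<^sub>0) (\<Pi>\<^sub>M i\<in>I. borel) (\<lambda>\<omega>. \<lambda>i\<in>I. score (\<theta> i) \<omega> - score_cov (\<theta> i) (\<theta> i) / 2))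
      (\<Pi>\<^sub>M i\<in>I. borel) (\<lambda>x. \<lambda>i\<in>I. ereal (x i))"
  if "finite I" for I :: "nat set"
proof -
  note [measurable] = measurable_score measurable_log_likelihood_ratio
  have "AE \<omega> in E \<theta>\<^sub>0. \<forall>i\<in>I. log_likelihood_ratio (E (\<theta> i)) (E \<theta>\<^sub>0) \<omega>
      = ereal (score (\<theta> i) \<omega> - score_cov (\<theta> i) (\<theta> i) / 2)"
    using log_likelihood_ratio_eq that by (simp add: AE_finite_all)
  then have "distr (E \<theta>\<^sub>0) (\<Pi>\<^sub>M i\<in>I. borel) (\<lambda>\<omega>. \<lambda>i\<in>I. log_likelihood_ratio (E (\<theta> i)) (E \<theta>\<^sub>0) \<omega>) =
    distr (E \<theta>\<^sub>0) (\<Pi>\<^sub>M i\<in>I. borel) (\<lambda>\<omega>. \<lambda>i\<in>I. ereal (score (\<theta> i) \<omega> - score_cov (\<theta> i) (\<theta> i) / 2))"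
    by (intro distr_cong_AE) (auto elim!: eventually_mono intro!: restrict_ext)
  moreover have "(\<lambda>x. \<lambda>i\<in>I. ereal (x i)) \<in> measurable (\<Pi>\<^sub>M i\<in>I. borel) (\<Pi>\<^sub>M i\<in>I. borel)"
    "(\<lambda>\<omega>. \<lambda>i\<in>I. score (\<theta> i) \<omega> - score_cov (\<theta> i) (\<theta> i) / 2) \<in> measurable (E \<theta>\<^sub>0) (\<Pi>\<^sub>M i\<in>I. borel)"
    by measurable
  ultimately show ?thesis
    by (simp add: distr_distr comp_def cong: restrict_cong)
qed

end

text \<open>The two observations may have unrelated index sets and kernels: equal score covariances
  give, by \<open>char_scores\<close>, equal joint characteristic functions of the
  exponents.\<close>

lemma le_cam_equivalent_gaussian:
  assumes E: "gaussian_experiment E T X K G c \<theta>\<^sub>0" and F: "gaussian_experiment F T' X' K' G' c' \<theta>\<^sub>0"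
    and cov: "\<And>\<theta> \<theta>'. cov_form K (G \<theta>) (G \<theta>') (c \<theta>) (c \<theta>') = cov_form K' (G' \<theta>) (G' \<theta>') (c' \<theta>) (c' \<theta>')"
  shows "le_cam_equivalent \<theta>\<^sub>0 E F"
proof -
  interpret E: gaussian_experiment E T X K G c \<theta>\<^sub>0 by fact
  interpret F: gaussian_experiment F T' X' K' G' c' \<theta>\<^sub>0 by fact
  note [measurable] = E.measurable_score F.measurable_score
  have cov': "F.score_cov \<theta> \<theta>' = E.score_cov \<theta> \<theta>'" for \<theta> \<theta>'
    by (simp add: E.score_cov_def F.score_cov_def cov)
  have charF: "(CLINT \<omega>|F \<theta>\<^sub>0. cis (\<Sum>i\<in>I. a i * (F.score (\<theta> i) \<omega> - F.score_cov (\<theta> i) (\<theta> i) / 2))) =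
      (CLINT \<omega>|E \<theta>\<^sub>0. cis (\<Sum>i\<in>I. a i * (E.score (\<theta> i) \<omega> - E.score_cov (\<theta> i) (\<theta> i) / 2)))"
    if "finite I" for I :: "nat set" and a \<theta>
    unfolding E.char_scores[OF that] F.char_scores[OF that] by (simp only: cov')
  have "distr (E \<theta>\<^sub>0) (\<Pi>\<^sub>M i\<in>{..<l}. borel) (\<lambda>\<omega>. \<lambda>i\<in>{..<l}. E.score (\<theta> i) \<omega> - E.score_cov (\<theta> i) (\<theta> i) / 2) =
    distr (F \<theta>\<^sub>0) (\<Pi>\<^sub>M i\<in>{..<l}. borel) (\<lambda>\<omega>. \<lambda>i\<in>{..<l}. F.score (\<theta> i) \<omega> - F.score_cov (\<theta> i) (\<theta> i) / 2)"
    for l :: nat and \<theta>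
    by (rule distr_PiM_eqI_char)
      (use E.prob_space_E F.prob_space_E in \<open>auto simp: prob_space_def charF\<close>)
  then show ?thesis
    unfolding le_cam_equivalent_def
    by (simp add: E.distr_log_likelihood_ratios F.distr_log_likelihood_ratios)
qed

section \<open>Gaussian vectors and Brownian motion as Gaussian processes\<close>

lemma cis_sum: "cis (\<Sum>i\<in>I. f i) = (\<Prod>i\<in>I. cis (f i))"
  by (induction I rule: infinite_finite_induct) (auto simp flip: cis_mult)

text \<open>\<open>jointly_gaussian\<close> only asserts that parameters exist; these moments
  identify them with the prescribed means and covariances. Integrability is recorded because a
  Bochner integral without it has the default value \<open>0\<close>.\<close>

lemma normal_law_moments:
  assumes "0 \<le> \<sigma>"
  shows "integrable (normal_law \<mu> \<sigma>) (\<lambda>x. x)" "(\<integral>x. x \<partial>normal_law \<mu> \<sigma>) = \<mu>"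
    and "integrable (normal_law \<mu> \<sigma>) (\<lambda>x. (x - \<mu>)\<^sup>2)" "(\<integral>x. (x - \<mu>)\<^sup>2 \<partial>normal_law \<mu> \<sigma>) = \<sigma>\<^sup>2"
proof -
  have "integrable (normal_law \<mu> \<sigma>) (\<lambda>x. x) \<and> (\<integral>x. x \<partial>normal_law \<mu> \<sigma>) = \<mu> \<and>
    integrable (normal_law \<mu> \<sigma>) (\<lambda>x. (x - \<mu>)\<^sup>2) \<and> (\<integral>x. (x - \<mu>)\<^sup>2 \<partial>normal_law \<mu> \<sigma>) = \<sigma>\<^sup>2"
  proof (cases "\<sigma> = 0")
    case True
    have N: "normal_law \<mu> \<sigma> = return borel \<mu>" using True by (simp add: normal_law_def)
    have int: "integrable (return borel \<mu>) f" and val: "(\<integral>x. f x \<partial>return borel \<mu>) = f \<mu>"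
      if "f \<in> borel_measurable borel" for f :: "real \<Rightarrow> real"
      using that by (auto intro!: integrableI_bounded simp: nn_integral_return integral_return)
    show ?thesis
      unfolding N
    proof (intro conjI)
      show "(\<integral>x. x \<partial>return borel \<mu>) = \<mu>" by (rule val) simp
      show "(\<integral>x. (x - \<mu>)\<^sup>2 \<partial>return borel \<mu>) = \<sigma>\<^sup>2" by (subst val) (auto simp: True)
      show "integrable (return borel \<mu>) (\<lambda>x. x)" by (rule int) simp
      show "integrable (return borel \<mu>) (\<lambda>x. (x - \<mu>)\<^sup>2)" by (rule int) simp
    qed
  next
    case False
    then have pos: "0 < \<sigma>" using assms by simp
    show ?thesis
      using pos integrable_normal_moment_nz_1[OF pos] integral_normal_moment_nz_1[OF pos]
        integrable_normal_moment[OF pos, of \<mu> 2] integral_normal_moment_even[OF pos, of \<mu> 1]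
      by (simp add: normal_law_def integrable_density integral_density)
  qed
  then show "integrable (normal_law \<mu> \<sigma>) (\<lambda>x. x)" "(\<integral>x. x \<partial>normal_law \<mu> \<sigma>) = \<mu>"
    "integrable (normal_law \<mu> \<sigma>) (\<lambda>x. (x - \<mu>)\<^sup>2)" "(\<integral>x. (x - \<mu>)\<^sup>2 \<partial>normal_law \<mu> \<sigma>) = \<sigma>\<^sup>2"
    by auto
qed

lemma moments_if_normal_law:
  assumes [measurable]: "Z \<in> borel_measurable M" and "0 \<le> \<sigma>" and D: "distr M borel Z = normal_law \<mu> \<sigma>"
  shows "integrable M Z" "(\<integral>\<omega>. Z \<omega> \<partial>M) = \<mu>"
    and "integrable M (\<lambda>\<omega>. (Z \<omega> - \<mu>)\<^sup>2)" "(\<integral>\<omega>. (Z \<omega> - \<mu>)\<^sup>2 \<partial>M) = \<sigma>\<^sup>2"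
  using normal_law_moments[OF \<open>0 \<le> \<sigma>\<close>, of \<mu>] unfolding D[symmetric]
  by (simp_all add: integrable_distr_eq integral_distr)

text \<open>\<open>f\<close> need not be injective: a path sampled at several times repeats its coordinate.\<close>

lemma gaussian_vector_char:
  assumes gv: "gaussian_vector M S X m A" and "finite S" "finite F" and f: "\<And>p. p \<in> F \<Longrightarrow> f p \<in> S"
  shows "(CLINT \<omega>|M. cis (\<Sum>p\<in>F. a p * X (f p) \<omega>)) = cis (\<Sum>p\<in>F. a p * m (f p)) *
    complex_of_real (exp (- (\<Sum>p\<in>F. \<Sum>q\<in>F. a p * a q * A (f p) (f q)) / 2))"
proof -
  have X [measurable]: "X i \<in> borel_measurable M" if "i \<in> S" for i
    using gv that by (auto simp: gaussian_vector_def jointly_gaussian_def)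
  have normal: "\<exists>\<mu>. \<exists>\<sigma>\<ge>0. distr M borel (\<lambda>\<omega>. \<Sum>i\<in>S. b i * X i \<omega>) = normal_law \<mu> \<sigma>" for b
    using gv by (auto simp: gaussian_vector_def jointly_gaussian_def)
  have mean: "(\<integral>\<omega>. X i \<omega> \<partial>M) = m i" if "i \<in> S" for i
    using gv that by (auto simp: gaussian_vector_def)
  have cov: "(\<integral>\<omega>. (X i \<omega> - m i) * (X j \<omega> - m j) \<partial>M) = A i j" if "i \<in> S" "j \<in> S" for i j
    using gv that mean by (auto simp: gaussian_vector_def covariance_def)
  have int: "integrable M (X i)" "integrable M (\<lambda>\<omega>. (X i \<omega> - m i)\<^sup>2)" if i: "i \<in> S" for i
  proof -
    have "(\<Sum>j\<in>S. of_bool (j = i) * X j \<omega>) = X i \<omega>" for \<omega>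
      using i \<open>finite S\<close> by (simp add: of_bool_def if_distrib[of "\<lambda>c. c * _"] cong: if_cong)
    then obtain \<mu> \<sigma> where \<sigma>: "0 \<le> \<sigma>" and D: "distr M borel (X i) = normal_law \<mu> \<sigma>"
      using normal[of "\<lambda>j. of_bool (j = i)"] by auto
    note moments = moments_if_normal_law[OF X[OF i] \<sigma> D]
    show "integrable M (X i)" by (rule moments(1))
    have "\<mu> = m i" using moments(2) mean[OF i] by (rule trans[OF sym])
    then show "integrable M (\<lambda>\<omega>. (X i \<omega> - m i)\<^sup>2)" using moments(3) by (simp only:)
  qed
  \<comment> \<open>Integrability of the products is what permits the variance of \<open>Z\<close>
    to be expanded into the covariances \<open>A\<close>; it comes from the second moments of the
    single coordinates.\<close>
  have intp: "integrable M (\<lambda>\<omega>. (X i \<omega> - m i) * (X j \<omega> - m j))" if "i \<in> S" "j \<in> S" for i j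
  proof (rule Bochner_Integration.integrable_bound)
    show "integrable M (\<lambda>\<omega>. (X i \<omega> - m i)\<^sup>2 + (X j \<omega> - m j)\<^sup>2)"
      using int that by auto
    have "\<bar>x * y\<bar> \<le> x\<^sup>2 + y\<^sup>2" for x y :: real
    proof -
      have "2 * (\<bar>x\<bar> * \<bar>y\<bar>) \<le> x\<^sup>2 + y\<^sup>2"
        using sum_squares_bound[of "\<bar>x\<bar>" "\<bar>y\<bar>"] by (simp add: mult.assoc)
      moreover have "0 \<le> \<bar>x\<bar> * \<bar>y\<bar>" by simp
      ultimately show ?thesis unfolding abs_mult by linarith
    qed
    then show "AE \<omega> in M. norm ((X i \<omega> - m i) * (X j \<omega> - m j)) \<le> norm ((X i \<omega> - m i)\<^sup>2 + (X j \<omega> - m j)\<^sup>2)"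
      by (auto intro!: AE_I2)
  qed (use that in measurable)
  define Z where "Z = (\<lambda>\<omega>. \<Sum>p\<in>F. a p * X (f p) \<omega>)"
  define \<mu>' where "\<mu>' = (\<Sum>p\<in>F. a p * m (f p))"
  have Z [measurable]: "Z \<in> borel_measurable M" unfolding Z_def using f by measurable
  \<comment> \<open>Summing coefficients over the fibres of \<open>f\<close> turns \<open>Z\<close>
    into a combination indexed by \<open>S\<close>, to which joint normality applies.\<close>
  have "(\<Sum>i\<in>S. (\<Sum>p\<in>{p\<in>F. f p = i}. a p) * X i \<omega>) = Z \<omega>" for \<omega>
  proof -
    have "(\<Sum>i\<in>S. (\<Sum>p\<in>{p\<in>F. f p = i}. a p) * X i \<omega>) = (\<Sum>i\<in>S. \<Sum>p\<in>{p\<in>F. f p = i}. a p * X (f p) \<omega>)"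
      by (simp add: sum_distrib_right)
    also have "\<dots> = Z \<omega>"
      unfolding Z_def using \<open>finite S\<close> \<open>finite F\<close> f by (intro sum.group) auto
    finally show ?thesis .
  qed
  with normal[of "\<lambda>i. \<Sum>p\<in>{p\<in>F. f p = i}. a p"]
  obtain \<mu> \<sigma> where \<sigma>: "0 \<le> \<sigma>" and D: "distr M borel Z = normal_law \<mu> \<sigma>" by auto
  have "(\<integral>\<omega>. Z \<omega> \<partial>M) = \<mu>'"
    unfolding Z_def \<mu>'_def using f int mean by (subst Bochner_Integration.integral_sum) auto
  then have \<mu>: "\<mu> = \<mu>'" using moments_if_normal_law(2)[OF Z \<sigma> D] by simp
  have "(Z \<omega> - \<mu>)\<^sup>2 = (\<Sum>p\<in>F. \<Sum>q\<in>F. a p * a q * ((X (f p) \<omega> - m (f p)) * (X (f q) \<omega> - m (f q))))" for \<omega>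
    unfolding \<mu> Z_def \<mu>'_def power2_eq_square sum_subtractf[symmetric] right_diff_distrib[symmetric]
    by (simp add: sum_product ac_simps)
  then have "\<sigma>\<^sup>2 = (\<integral>\<omega>. (\<Sum>p\<in>F. \<Sum>q\<in>F. a p * a q * ((X (f p) \<omega> - m (f p)) * (X (f q) \<omega> - m (f q)))) \<partial>M)"
    using moments_if_normal_law(4)[OF Z \<sigma> D] by simp
  also have "\<dots> = (\<Sum>p\<in>F. \<Sum>q\<in>F. a p * a q * A (f p) (f q))"
    using f intp by (simp add: Bochner_Integration.integral_sum cov)
  finally have "\<sigma>\<^sup>2 = (\<Sum>p\<in>F. \<Sum>q\<in>F. a p * a q * A (f p) (f q))" .
  moreover have "(CLINT \<omega>|M. cis (Z \<omega>)) = (CLINT x|normal_law \<mu> \<sigma>. cis (1 * x))"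
    unfolding D[symmetric] by (simp add: integral_distr)
  ultimately show ?thesis
    using char_normal_law[OF \<sigma>, of \<mu> 1] \<mu> by (simp add: Z_def \<mu>'_def)
qed

section \<open>Finite-dimensional laws of Brownian motion\<close>

text \<open>Increments are independent along strictly increasing grids. The grid is made to start at
  \<open>0\<close>, where the paths vanish almost surely, so that values of the path become sums of
  increments.\<close>

lemma finite_times_enumerate:
  fixes U :: "real set"
  assumes "finite U" "U \<subseteq> {0..1}"
  shows "\<exists>n t. t 0 = 0 \<and> (\<forall>j<n. t j < t (Suc j)) \<and> t n \<le> 1 \<and> U \<subseteq> t ` {..n :: nat}"
proof -
  \<comment> \<open>The last grid point is kept in \<open>insert 0 U\<close>, so that a new largest
    time lies beyond it, unless that time is \<open>0\<close> and already on the grid.\<close>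
  have "\<exists>n t. t 0 = 0 \<and> (\<forall>j<n. t j < t (Suc j)) \<and> t n \<in> insert 0 U \<and> U \<subseteq> t ` {..n}"
    using assms
  proof (induction U rule: finite_linorder_max_induct)
    case empty
    show ?case by (intro exI[of _ 0] exI[of _ "\<lambda>_. 0"]) auto
  next
    case (insert b U)
    then obtain n t where t: "t 0 = 0" "\<forall>j<n. t j < t (Suc j)" "t n \<in> insert 0 U" "U \<subseteq> t ` {..n}"
      by auto
    show ?case
    proof (cases "b = 0")
      case True
      then show ?thesis using t by (intro exI[of _ n] exI[of _ t]) force
    next
      case False
      then have "t n < b" using t(3) insert by auto
      moreover have "U \<subseteq> (t(Suc n := b)) ` {..Suc n}"
        using t(4) by (force simp: image_iff)
      ultimately show ?thesis
        using t by (intro exI[of _ "Suc n"] exI[of _ "t(Suc n := b)"]) (auto simp: less_Suc_eq)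
    qed
  qed
  then obtain n t where "t 0 = 0" "\<forall>j<n. t j < t (Suc j)" "t n \<in> insert 0 U" "U \<subseteq> t ` {..n}" by blast
  moreover from this assms(2) have "t n \<le> 1" by auto
  ultimately show ?thesis by blast
qed

text \<open>Because \<open>u\<close> is a grid point, the indicator keeps exactly the cells to the
  left of \<open>u\<close> and the sum telescopes. It is used with \<open>g\<close> a path for the
  process and with \<open>g\<close> the identity for drift and covariance.\<close>

lemma sum_increments:
  fixes t :: "nat \<Rightarrow> real" and g :: "real \<Rightarrow> real"
  assumes t: "\<And>j. j < n \<Longrightarrow> t j < t (Suc j)" and u: "u \<in> t ` {..n}"
  shows "(\<Sum>j<n. of_bool (t (Suc j) \<le> u) * (g (t (Suc j)) - g (t j))) = g u - g (t 0)"
proof -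
  obtain k where k: "k \<le> n" "u = t k" using u by auto
  have less: "t i < t j" if "i < j" "j \<le> n" for i j
    using that(1,2)
  proof (induction j rule: less_induct)
    case (less j)
    then obtain j' where j': "j = Suc j'" by (cases j) auto
    then show ?case using less.IH[of j'] less.prems t[of j'] by (cases "i = j'") auto
  qed
  have "t (Suc j) \<le> u \<longleftrightarrow> j < k" if "j < n" for j
    using less[of "Suc j" k] less[of k "Suc j"] that k by (cases "Suc j" k rule: linorder_cases) auto
  then have "(\<Sum>j<n. of_bool (t (Suc j) \<le> u) * (g (t (Suc j)) - g (t j))) = (\<Sum>j<k. g (t (Suc j)) - g (t j))"
    using k by (intro sum.mono_neutral_cong_right) auto
  then show ?thesis using k sum_lessThan_telescope[of "\<lambda>j. g (t j)" k] by (simp only:)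
qed

text \<open>On a grid through all the times, the combination is almost surely a sum of terms
  \<open>D j\<close>, each built from the increment over one cell. These are independent, so the
  characteristic functions multiply and each factor is that of a Gaussian vector.\<close>

lemma (in prob_space) brownian_motion_char:
  assumes bm: "brownian_motion M S W b A" and "finite S" "finite F"
    and f: "\<And>p. p \<in> F \<Longrightarrow> f p \<in> S" and u: "\<And>p. p \<in> F \<Longrightarrow> u p \<in> {0..1}"
  shows "(CLINT \<omega>|M. cis (\<Sum>p\<in>F. a p * W (f p) (u p) \<omega>)) = cis (\<Sum>p\<in>F. a p * (u p * b (f p))) *
    complex_of_real (exp (- (\<Sum>p\<in>F. \<Sum>q\<in>F. a p * a q * (min (u p) (u q) * A (f p) (f q))) / 2))"
proof -
  have "finite (u ` F)" "u ` F \<subseteq> {0..1}" using \<open>finite F\<close> u by auto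
  from finite_times_enumerate[OF this] obtain n t where t: "t 0 = 0" "t n \<le> 1" "u ` F \<subseteq> t ` {..n}"
    and "\<forall>j<n. t j < t (Suc j)" by blast
  then have t_less: "t j < t (Suc j)" if "j < n" for j using that by blast
  have t01: "t j \<in> {0..1}" if "j \<le> n" for j
  proof -
    have "t i \<le> t j" if "i \<le> j" "j \<le> n" for i j
      using that
    proof (induction rule: dec_induct)
      case (step k)
      then show ?case using t_less[of k] by simp
    qed simp
    from this[of 0 j] this[of j n] show ?thesis using that t(1,2) by simp
  qed
  have W [measurable]: "W i v \<in> borel_measurable M" if "i \<in> S" "v \<in> {0..1}" for i v
    using bm that by (auto simp: brownian_motion_def)
  \<comment> \<open>The weight of the increment over cell \<open>j\<close> in term \<open>p\<close>:
    the coefficient \<open>a p\<close> if the cell lies before time \<open>u p\<close>, otherwise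
    zero.\<close>
  define \<beta> where "\<beta> = (\<lambda>j p. a p * of_bool (t (Suc j) \<le> u p))"
  define D where "D = (\<lambda>j \<omega>. \<Sum>p\<in>F. \<beta> j p * (W (f p) (t (Suc j)) \<omega> - W (f p) (t j) \<omega>))"
  have D_meas [measurable]: "D j \<in> borel_measurable M" if "j < n" for j
    unfolding D_def using f t01 that by (intro borel_measurable_sum borel_measurable_times borel_measurable_diff W) auto
  have incr: "(\<Sum>j<n. \<beta> j p * (g (t (Suc j)) - g (t j))) = a p * (g (u p) - g 0)" if "p \<in> F" for p g
    using sum_increments[of n t, OF t_less, where g = g and u = "u p"] that t(1,3)
    by (auto simp: \<beta>_def mult.assoc sum_distrib_left[symmetric])
  have "AE \<omega> in M. \<forall>i\<in>S. W i 0 \<omega> = 0" using bm by (simp add: brownian_motion_def)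
  then have sumD: "AE \<omega> in M. (\<Sum>p\<in>F. a p * W (f p) (u p) \<omega>) = (\<Sum>j<n. D j \<omega>)"
  proof (rule eventually_mono)
    fix \<omega> assume "\<forall>i\<in>S. W i 0 \<omega> = 0"
    have "(\<Sum>p\<in>F. a p * W (f p) (u p) \<omega>) =
        (\<Sum>p\<in>F. \<Sum>j<n. \<beta> j p * (W (f p) (t (Suc j)) \<omega> - W (f p) (t j) \<omega>))"
    proof (intro sum.cong refl)
      fix p assume "p \<in> F"
      then show "a p * W (f p) (u p) \<omega> = (\<Sum>j<n. \<beta> j p * (W (f p) (t (Suc j)) \<omega> - W (f p) (t j) \<omega>))"
        using incr[of p "\<lambda>v. W (f p) v \<omega>"] f \<open>\<forall>i\<in>S. W i 0 \<omega> = 0\<close> by simp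
    qed
    then show "(\<Sum>p\<in>F. a p * W (f p) (u p) \<omega>) = (\<Sum>j<n. D j \<omega>)"
      unfolding D_def by (simp add: sum.swap[of _ F])
  qed
  have "indep_vars (\<lambda>_. \<Pi>\<^sub>M i\<in>S. borel) (\<lambda>j \<omega>. \<lambda>i\<in>S. W i (t (Suc j)) \<omega> - W i (t j) \<omega>) {..<n}"
  proof -
    have "0 \<le> t 0 \<and> (\<forall>j<n. t j < t (Suc j)) \<and> t n \<le> 1" using t t_less by auto
    then show ?thesis using bm unfolding brownian_motion_def by (elim conjE) (erule allE, erule allE, erule mp, simp)
  qed
  from indep_vars_compose2[OF this, of "\<lambda>j x. cis (\<Sum>p\<in>F. \<beta> j p * x (f p))" "\<lambda>_. borel"] f
  have indep: "indep_vars (\<lambda>_. borel) (\<lambda>j \<omega>. cis (D j \<omega>)) {..<n}"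
    by (simp add: D_def)
  have charD: "(CLINT \<omega>|M. cis (D j \<omega>)) = cis (\<Sum>p\<in>F. \<beta> j p * ((t (Suc j) - t j) * b (f p))) *
      complex_of_real (exp (- (\<Sum>p\<in>F. \<Sum>q\<in>F. \<beta> j p * \<beta> j q * ((t (Suc j) - t j) * A (f p) (f q))) / 2))"
    if "j < n" for j
  proof -
    have "0 \<le> t j \<and> t j < t (Suc j) \<and> t (Suc j) \<le> 1" using t01[of j] t01[of "Suc j"] t_less that by auto
    then have "gaussian_vector M S (\<lambda>i \<omega>. W i (t (Suc j)) \<omega> - W i (t j) \<omega>)
        (\<lambda>i. (t (Suc j) - t j) * b i) (\<lambda>i k. (t (Suc j) - t j) * A i k)"
      using bm unfolding brownian_motion_def by blast
    from gaussian_vector_char[OF this \<open>finite S\<close> \<open>finite F\<close>, of f "\<beta> j"] f show ?thesis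
      by (simp add: D_def)
  qed
  have mean: "(\<Sum>j<n. \<Sum>p\<in>F. \<beta> j p * ((t (Suc j) - t j) * b (f p))) = (\<Sum>p\<in>F. a p * (u p * b (f p)))"
  proof -
    have "(\<Sum>j<n. \<beta> j p * ((t (Suc j) - t j) * b (f p))) = a p * (u p * b (f p))" if "p \<in> F" for p
      using incr[OF that, of "\<lambda>v. v"] by (simp add: sum_distrib_right[symmetric] mult.assoc[symmetric])
    then show ?thesis by (subst sum.swap) simp
  qed
  \<comment> \<open>A cell counts for the pair \<open>p\<close>, \<open>q\<close> only if it
    precedes both times, that is, precedes their minimum; the cell lengths then telescope to
    \<open>min (u p) (u q)\<close>.\<close>
  have var: "(\<Sum>j<n. \<Sum>p\<in>F. \<Sum>q\<in>F. \<beta> j p * \<beta> j q * ((t (Suc j) - t j) * A (f p) (f q))) =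
      (\<Sum>p\<in>F. \<Sum>q\<in>F. a p * a q * (min (u p) (u q) * A (f p) (f q)))"
  proof -
    have "(\<Sum>j<n. \<beta> j p * \<beta> j q * ((t (Suc j) - t j) * A (f p) (f q))) =
        a p * a q * (min (u p) (u q) * A (f p) (f q))" if "p \<in> F" "q \<in> F" for p q
    proof -
      have "(\<Sum>j<n. of_bool (t (Suc j) \<le> min (u p) (u q)) * (t (Suc j) - t j)) = min (u p) (u q)"
        using sum_increments[of n t, OF t_less, where g = "\<lambda>v. v" and u = "min (u p) (u q)"] that t(1,3)
        by (auto simp: min_def)
      then have "a p * a q * (min (u p) (u q) * A (f p) (f q)) =
          (\<Sum>j<n. a p * a q * (of_bool (t (Suc j) \<le> min (u p) (u q)) * (t (Suc j) - t j) * A (f p) (f q)))"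
        by (simp only: sum_distrib_left[symmetric] sum_distrib_right[symmetric])
      then show ?thesis
        by (simp add: \<beta>_def) (auto intro!: sum.cong)
    qed
    note key = this
    have "(\<Sum>j<n. \<Sum>q\<in>F. \<beta> j p * \<beta> j q * ((t (Suc j) - t j) * A (f p) (f q))) =
        (\<Sum>q\<in>F. a p * a q * (min (u p) (u q) * A (f p) (f q)))" if "p \<in> F" for p
      by (subst sum.swap) (simp add: key that)
    then show ?thesis by (subst sum.swap) simp
  qed
  have "(CLINT \<omega>|M. cis (\<Sum>p\<in>F. a p * W (f p) (u p) \<omega>)) = (CLINT \<omega>|M. (\<Prod>j<n. cis (D j \<omega>)))"
    unfolding cis_sum[symmetric]
    using sumD f u by (intro integral_cong_AE) (auto elim!: eventually_mono)
  also have "\<dots> = (\<Prod>j<n. CLINT \<omega>|M. cis (D j \<omega>))"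
    using indep by (intro indep_vars_lebesgue_integral) (auto intro: integrable_cis)
  also have "\<dots> = cis (\<Sum>j<n. \<Sum>p\<in>F. \<beta> j p * ((t (Suc j) - t j) * b (f p))) *
      complex_of_real (exp (\<Sum>j<n. - (\<Sum>p\<in>F. \<Sum>q\<in>F. \<beta> j p * \<beta> j q * ((t (Suc j) - t j) * A (f p) (f q))) / 2))"
    by (simp add: charD prod.distrib cis_sum exp_sum)
  finally show ?thesis
    unfolding mean by (simp add: sum_negf var flip: sum_divide_distrib)
qed

section \<open>The shift and the drift experiment\<close>

text \<open>A single kernel on all coordinates at once. Each \<open>info_matrix\<close> is its
  pullback along \<open>map_sum id \<eta>s\<close>, so a direction listed twice merely repeats a
  coordinate.\<close>

definition info_kernel ::
  "real^'k^'k \<Rightarrow> ('h \<Rightarrow> real^'k) \<Rightarrow> ('h \<Rightarrow> 'h \<Rightarrow> real) \<Rightarrow> 'k + 'h \<Rightarrow> 'k + 'h \<Rightarrow> real" where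
  "info_kernel J\<^sub>I\<^sub>I J\<^sub>I J s t =
     (case s of
        Inl i \<Rightarrow> (case t of Inl j \<Rightarrow> J\<^sub>I\<^sub>I $ i $ j | Inr h \<Rightarrow> J\<^sub>I h $ i)
      | Inr h \<Rightarrow> (case t of Inl j \<Rightarrow> J\<^sub>I h $ j | Inr h' \<Rightarrow> J h h'))"

text \<open>The coefficients of the score. The direction \<open>\<eta>\<close> contributes one unit
  coefficient at its own coordinate, without any expansion in a basis.\<close>

definition direction :: "(real^'k) \<times> 'h \<Rightarrow> 'k + 'h \<Rightarrow> real" where
  "direction \<theta> = case_sum (\<lambda>i. fst \<theta> $ i) (\<lambda>h. of_bool (h = snd \<theta>))"

definition direction_support :: "(real^'k) \<times> 'h \<Rightarrow> ('k + 'h) set" where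
  "direction_support \<theta> = insert (Inr (snd \<theta>)) (range Inl)"

lemma finite_direction_support [simp]: "finite (direction_support \<theta>)"
  by (simp add: direction_support_def)

lemma sum_direction:
  "(\<Sum>s\<in>direction_support (\<tau>, \<eta>). direction (\<tau>, \<eta>) s * f s) = (\<Sum>i\<in>UNIV. \<tau> $ i * f (Inl i)) + f (Inr \<eta>)"
  by (subst direction_support_def, subst sum.insert) (auto simp: direction_def sum.reindex)

lemma info_matrix_eq_kernel:
  "info_matrix J\<^sub>I\<^sub>I J\<^sub>I J \<eta>s c d = info_kernel J\<^sub>I\<^sub>I J\<^sub>I J (map_sum id \<eta>s c) (map_sum id \<eta>s d)"
  by (cases c; cases d) (auto simp: info_kernel_def)

text \<open>The prescribed mean of a coordinate is its covariance with the score, as the locale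
  \<open>gaussian_experiment\<close> demands.\<close>

lemma local_mean_eq_kernel:
  "local_mean J\<^sub>I\<^sub>I J\<^sub>I J \<tau> \<eta> \<eta>s c =
    (\<Sum>s\<in>direction_support (\<tau>, \<eta>). direction (\<tau>, \<eta>) s * info_kernel J\<^sub>I\<^sub>I J\<^sub>I J (map_sum id \<eta>s c) s)"
  unfolding sum_direction
  by (cases c) (auto simp: local_mean_def stack_def info_kernel_def matrix_vector_mult_def inner_vec_def mult.commute)

text \<open>Both experiments are specified along finite sequences of directions only; this lifts any
  finite set of coordinates to positions in such a sequence.\<close>

lemma coordinates_enumerate:
  fixes F :: "('k + 'h) set"
  assumes "finite F"
  shows "\<exists>(l :: nat) \<eta>s g. \<forall>p\<in>F. g p \<in> UNIV <+> {..<l} \<and> map_sum id \<eta>s (g p) = p"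
proof -
  have "finite {h. Inr h \<in> F}"
    using finite_vimageI[OF assms, of Inr] by (simp add: vimage_def)
  then obtain hs where hs: "set hs = {h. Inr h \<in> F}" using finite_list by metis
  have "\<exists>q. q \<in> UNIV <+> {..<length hs} \<and> map_sum id ((!) hs) q = p" if "p \<in> F" for p
  proof (cases p)
    case (Inl i)
    then show ?thesis by (intro exI[of _ "Inl i"]) auto
  next
    case (Inr h)
    then have "h \<in> set hs" using hs that by simp
    then obtain j where "j < length hs" "hs ! j = h" by (auto simp: in_set_conv_nth)
    then show ?thesis using Inr by (intro exI[of _ "Inr j"]) auto
  qed
  then have "\<forall>p\<in>F. \<exists>q. q \<in> UNIV <+> {..<length hs} \<and> map_sum id ((!) hs) q = p" by blast
  from bchoice[OF this] show ?thesis by blast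
qed

lemma (in information_quantities) info_kernel_sym:
  "info_kernel J\<^sub>I\<^sub>I J\<^sub>I J s t = info_kernel J\<^sub>I\<^sub>I J\<^sub>I J t s"
proof -
  \<comment> \<open>With no nuisance direction the information matrix is
    \<open>J\<^sub>I\<^sub>I\<close> alone; its entries are covariances, hence symmetric.\<close>
  obtain M :: "('k + nat \<Rightarrow> real) measure" where M: "\<And>c d. c \<in> UNIV <+> {..<0} \<Longrightarrow> d \<in> UNIV <+> {..<0} \<Longrightarrow>
      covariance M (\<lambda>x. x c) (\<lambda>x. x d) = info_matrix J\<^sub>I\<^sub>I J\<^sub>I J (\<lambda>_. 0) c d"
    using info_matrix_covariance[of 0 "\<lambda>_. 0"] unfolding is_covariance_matrix_def by blast
  have "J\<^sub>I\<^sub>I $ i $ j = J\<^sub>I\<^sub>I $ j $ i" for i j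
    using M[of "Inl i" "Inl j"] M[of "Inl j" "Inl i"] by (auto simp: covariance_def mult.commute)
  then show ?thesis
    using J_sym by (auto simp: info_kernel_def split: sum.split)
qed

text \<open>At the parameter \<open>(0, 0)\<close> the score is the nuisance coordinate of direction
  \<open>0\<close>; its vanishing covariances make the base measure centred.\<close>

lemma (in information_quantities) info_kernel_zero: "info_kernel J\<^sub>I\<^sub>I J\<^sub>I J t (Inr 0) = 0"
  using J_zero J_sym J\<^sub>I_zero by (auto simp: info_kernel_def split: sum.split)

context information_quantities
begin

abbreviation "info \<equiv> info_kernel J\<^sub>I\<^sub>I J\<^sub>I J"

lemma gaussian_experiment_shift:
  assumes "gaussian_shift_experiment J\<^sub>I\<^sub>I J\<^sub>I J P \<Delta>int \<Delta>nuis"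
  shows "gaussian_experiment P UNIV (case_sum (\<lambda>i \<omega>. \<Delta>int \<omega> $ i) \<Delta>nuis) info direction_support direction (0, 0)"
proof
  let ?X = "case_sum (\<lambda>i \<omega>. \<Delta>int \<omega> $ i) \<Delta>nuis"
  have gv: "gaussian_vector (P (\<tau>, \<eta>)) (UNIV <+> {..<l}) (\<lambda>c \<omega>. stack (\<Delta>int \<omega>) (\<lambda>a. \<Delta>nuis (\<eta>s a) \<omega>) c)
        (local_mean J\<^sub>I\<^sub>I J\<^sub>I J \<tau> \<eta> \<eta>s) (info_matrix J\<^sub>I\<^sub>I J\<^sub>I J \<eta>s)" for \<tau> \<eta> l \<eta>s
    using assms unfolding gaussian_shift_experiment_def by blast
  have X: "stack (\<Delta>int \<omega>) (\<lambda>a. \<Delta>nuis (\<eta>s a) \<omega>) c = ?X (map_sum id \<eta>s c) \<omega>" for \<omega> \<eta>s c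
    by (cases c) (auto simp: stack_def)
  show "experiment_observing P UNIV ?X"
    using assms by (simp add: gaussian_shift_experiment_def)
  show "gaussian_process (P \<theta>) UNIV ?X (\<lambda>t. \<Sum>s\<in>direction_support \<theta>. direction \<theta> s * info t s) info" for \<theta>
    unfolding gaussian_process_def
  proof (intro conjI ballI allI impI)
    obtain \<tau> \<eta> where \<theta>: "\<theta> = (\<tau>, \<eta>)" by (cases \<theta>)
    {
      fix t :: "'k + 'h"
      obtain l :: nat and \<eta>s g where g: "\<forall>p\<in>{t}. g p \<in> UNIV <+> {..<l} \<and> map_sum id \<eta>s (g p) = p"
        using coordinates_enumerate[of "{t}"] by blast
      have "\<forall>c\<in>UNIV <+> {..<l}. (\<lambda>\<omega>. ?X (map_sum id \<eta>s c) \<omega>) \<in> borel_measurable (P \<theta>)"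
        using gv[of \<tau> \<eta> l \<eta>s] unfolding gaussian_vector_def jointly_gaussian_def X \<theta> by blast
      from this[rule_format, of "g t"] g show "?X t \<in> borel_measurable (P \<theta>)" by simp
    }
    fix F :: "('k + 'h) set" and a assume F: "finite F \<and> F \<subseteq> UNIV"
    obtain l :: nat and \<eta>s g where g: "\<forall>p\<in>F. g p \<in> UNIV <+> {..<l} \<and> map_sum id \<eta>s (g p) = p"
      using coordinates_enumerate[of F] F by blast
    show "(CLINT \<omega>|P \<theta>. cis (\<Sum>t\<in>F. a t * ?X t \<omega>)) =
      cis (\<Sum>t\<in>F. a t * (\<Sum>s\<in>direction_support \<theta>. direction \<theta> s * info t s)) *
      complex_of_real (exp (- (\<Sum>s\<in>F. \<Sum>t\<in>F. a s * a t * info s t) / 2))"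
      using gaussian_vector_char[OF gv[of \<tau> \<eta> l \<eta>s], of F g a] F g
      by (simp add: X local_mean_eq_kernel info_matrix_eq_kernel \<theta>)
  qed
  show "(\<Sum>s\<in>direction_support (0, 0). direction (0, 0) s * info t s) = 0" for t
    by (simp add: sum_direction info_kernel_zero)
qed (auto intro: info_kernel_sym)

text \<open>Coordinates are pairs of a component and a time, with kernel
  \<open>min u v * info c d\<close>. The score is taken at time \<open>1\<close>: since
  \<open>min u 1 = u\<close> on the unit interval, its covariance with the path at time
  \<open>u\<close> is the drift multiplied by \<open>u\<close>.\<close>

lemma gaussian_experiment_drift:
  assumes "brownian_drift_experiment J\<^sub>I\<^sub>I J\<^sub>I J P Wint Wnuis"
  shows "gaussian_experiment P (UNIV \<times> {0..1})
    (\<lambda>(c, u). case_sum (\<lambda>i \<omega>. Wint u \<omega> $ i) (\<lambda>\<eta>' \<omega>. Wnuis \<eta>' u \<omega>) c)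
    (\<lambda>(c, u) (d, v). min u v * info c d)
    (\<lambda>\<theta>. direction_support \<theta> \<times> {1}) (\<lambda>\<theta> (d, v). direction \<theta> d) (0, 0)"
proof
  let ?X = "\<lambda>(c, u). case_sum (\<lambda>i \<omega>. Wint u \<omega> $ i) (\<lambda>\<eta>' \<omega>. Wnuis \<eta>' u \<omega>) c"
  let ?K = "\<lambda>(c, u) (d, v). min u v * info c d"
  have bm: "brownian_motion (P (\<tau>, \<eta>)) (UNIV <+> {..<l}) (\<lambda>c u \<omega>. stack (Wint u \<omega>) (\<lambda>a. Wnuis (\<eta>s a) u \<omega>) c)
        (local_mean J\<^sub>I\<^sub>I J\<^sub>I J \<tau> \<eta> \<eta>s) (info_matrix J\<^sub>I\<^sub>I J\<^sub>I J \<eta>s)" for \<tau> \<eta> l \<eta>s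
    using assms unfolding brownian_drift_experiment_def by blast
  have X: "stack (Wint u \<omega>) (\<lambda>a. Wnuis (\<eta>s a) u \<omega>) c = ?X (map_sum id \<eta>s c, u) \<omega>" for \<omega> \<eta>s c u
    by (cases c) (auto simp: stack_def)
  have mean: "(\<Sum>s\<in>direction_support \<theta> \<times> {1}. (case s of (d, v) \<Rightarrow> direction \<theta> d) * ?K t s) =
      snd t * (\<Sum>s\<in>direction_support \<theta>. direction \<theta> s * info (fst t) s)"
    if "t \<in> UNIV \<times> {0..1}" for t \<theta>
    using that by (auto simp: sum.cartesian_product' sum_distrib_left min_absorb1 ac_simps)
  show "experiment_observing P (UNIV \<times> {0..1}) ?X"
    using assms by (simp add: brownian_drift_experiment_def)
  show "gaussian_process (P \<theta>) (UNIV \<times> {0..1}) ?X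
      (\<lambda>t. \<Sum>s\<in>direction_support \<theta> \<times> {1}. (case s of (d, v) \<Rightarrow> direction \<theta> d) * ?K t s) ?K" for \<theta>
    unfolding gaussian_process_def
  proof (intro conjI ballI allI impI)
    obtain \<tau> \<eta> where \<theta>: "\<theta> = (\<tau>, \<eta>)" by (cases \<theta>)
    {
      fix t :: "('k + 'h) \<times> real" assume t: "t \<in> UNIV \<times> {0..1}"
      obtain l :: nat and \<eta>s g where g: "\<forall>p\<in>{fst t}. g p \<in> UNIV <+> {..<l} \<and> map_sum id \<eta>s (g p) = p"
        using coordinates_enumerate[of "{fst t}"] by blast
      have "\<forall>i\<in>UNIV <+> {..<l}. \<forall>u\<in>{0..1}. (\<lambda>\<omega>. ?X (map_sum id \<eta>s i, u) \<omega>) \<in> borel_measurable (P \<theta>)"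
        using bm[of \<tau> \<eta> l \<eta>s] unfolding brownian_motion_def X \<theta> by blast
      from this[rule_format, of "g (fst t)" "snd t"] show "?X t \<in> borel_measurable (P \<theta>)"
        using t g by auto
    }
    fix F :: "(('k + 'h) \<times> real) set" and a assume F: "finite F \<and> F \<subseteq> UNIV \<times> {0..1}"
    then have F': "finite F" "finite (fst ` F)" "\<And>p. p \<in> F \<Longrightarrow> snd p \<in> {0..1}" by auto
    obtain l :: nat and \<eta>s g where g: "\<forall>p\<in>fst ` F. g p \<in> UNIV <+> {..<l} \<and> map_sum id \<eta>s (g p) = p"
      using coordinates_enumerate[OF F'(2)] by blast
    interpret prob_space "P \<theta>"
      using assms unfolding brownian_drift_experiment_def experiment_observing_def by blast
    have gS: "\<And>p. p \<in> F \<Longrightarrow> g (fst p) \<in> UNIV <+> {..<l}" using g by auto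
    have "(CLINT \<omega>|P \<theta>. cis (\<Sum>p\<in>F. a p * ?X (map_sum id \<eta>s (g (fst p)), snd p) \<omega>)) =
      cis (\<Sum>p\<in>F. a p * (snd p * local_mean J\<^sub>I\<^sub>I J\<^sub>I J \<tau> \<eta> \<eta>s (g (fst p)))) *
      complex_of_real (exp (- (\<Sum>p\<in>F. \<Sum>q\<in>F. a p * a q *
        (min (snd p) (snd q) * info_matrix J\<^sub>I\<^sub>I J\<^sub>I J \<eta>s (g (fst p)) (g (fst q)))) / 2))"
      unfolding X[symmetric]
      by (rule brownian_motion_char[OF bm[of \<tau> \<eta> l \<eta>s, folded \<theta>] _ F'(1) gS F'(3)]) simp_all
    moreover have "(\<Sum>p\<in>F. a p * ?X (map_sum id \<eta>s (g (fst p)), snd p) \<omega>) = (\<Sum>p\<in>F. a p * ?X p \<omega>)" for \<omega>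
      using g by (intro sum.cong) auto
    moreover have "(\<Sum>p\<in>F. a p * (snd p * local_mean J\<^sub>I\<^sub>I J\<^sub>I J \<tau> \<eta> \<eta>s (g (fst p)))) =
        (\<Sum>t\<in>F. a t * (\<Sum>s\<in>direction_support \<theta> \<times> {1}. (case s of (d, v) \<Rightarrow> direction \<theta> d) * ?K t s))"
      using F g by (intro sum.cong refl, subst mean) (auto simp: local_mean_eq_kernel \<theta>)
    moreover have "(\<Sum>p\<in>F. \<Sum>q\<in>F. a p * a q * (min (snd p) (snd q) * info_matrix J\<^sub>I\<^sub>I J\<^sub>I J \<eta>s (g (fst p)) (g (fst q)))) =
        (\<Sum>s\<in>F. \<Sum>t\<in>F. a s * a t * ?K s t)"
      using g by (intro sum.cong refl) (auto simp: info_matrix_eq_kernel split: prod.split)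
    ultimately show "(CLINT \<omega>|P \<theta>. cis (\<Sum>t\<in>F. a t * ?X t \<omega>)) =
      cis (\<Sum>t\<in>F. a t * (\<Sum>s\<in>direction_support \<theta> \<times> {1}. (case s of (d, v) \<Rightarrow> direction \<theta> d) * ?K t s)) *
      complex_of_real (exp (- (\<Sum>s\<in>F. \<Sum>t\<in>F. a s * a t * ?K s t) / 2))"
      by (simp only:)
  qed
  show "(\<Sum>s\<in>direction_support (0, 0) \<times> {1}. (case s of (d, v) \<Rightarrow> direction (0, 0) d) * ?K t s) = 0"
    if "t \<in> UNIV \<times> {0..1}" for t
    unfolding mean[OF that] by (simp add: sum_direction info_kernel_zero)
qed (auto simp: min.commute intro: info_kernel_sym)

text \<open>Both scores of the drift experiment sit at time \<open>1\<close>, where the factor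
  \<open>min 1 1\<close> is \<open>1\<close> and the kernel reduces to that of the shift
  experiment.\<close>

lemma cov_form_shift_drift:
  "cov_form info (direction_support \<theta>) (direction_support \<theta>') (direction \<theta>) (direction \<theta>') =
    cov_form (\<lambda>(c, u) (d, v). min u v * info c d) (direction_support \<theta> \<times> {1 :: real}) (direction_support \<theta>' \<times> {1})
      (\<lambda>(d, v). direction \<theta> d) (\<lambda>(d, v). direction \<theta>' d)"
  by (simp add: cov_form_def sum.cartesian_product')

end

theorem proposition2p1:
  fixes J\<^sub>I\<^sub>I :: "real^'k^'k"
    and J\<^sub>I :: "'h::{real_vector, topological_space} \<Rightarrow> real^'k"
    and J :: "'h \<Rightarrow> 'h \<Rightarrow> real"
    and P\<^sub>s\<^sub>h\<^sub>i\<^sub>f\<^sub>t :: "(real^'k) \<times> 'h \<Rightarrow> 'a measure"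
    and \<Delta>\<^sub>i\<^sub>n\<^sub>t :: "'a \<Rightarrow> real^'k"
    and \<Delta>\<^sub>n\<^sub>u\<^sub>i\<^sub>s :: "'h \<Rightarrow> 'a \<Rightarrow> real"
    and P\<^sub>d\<^sub>r\<^sub>i\<^sub>f\<^sub>t :: "(real^'k) \<times> 'h \<Rightarrow> 'b measure"
    and W\<^sub>i\<^sub>n\<^sub>t :: "real \<Rightarrow> 'b \<Rightarrow> real^'k"
    and W\<^sub>n\<^sub>u\<^sub>i\<^sub>s :: "'h \<Rightarrow> real \<Rightarrow> 'b \<Rightarrow> real"
  assumes separable: "separable_space (euclidean :: 'h topology)"
    and infinite_dim: "\<not> (\<exists>B :: 'h set. finite B \<and> span B = UNIV)"
    and information: "information_quantities J\<^sub>I\<^sub>I J\<^sub>I J"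
    and shift: "gaussian_shift_experiment J\<^sub>I\<^sub>I J\<^sub>I J P\<^sub>s\<^sub>h\<^sub>i\<^sub>f\<^sub>t \<Delta>\<^sub>i\<^sub>n\<^sub>t \<Delta>\<^sub>n\<^sub>u\<^sub>i\<^sub>s"
    and drift: "brownian_drift_experiment J\<^sub>I\<^sub>I J\<^sub>I J P\<^sub>d\<^sub>r\<^sub>i\<^sub>f\<^sub>t W\<^sub>i\<^sub>n\<^sub>t W\<^sub>n\<^sub>u\<^sub>i\<^sub>s"
  shows "le_cam_equivalent (0, 0) P\<^sub>s\<^sub>h\<^sub>i\<^sub>f\<^sub>t P\<^sub>d\<^sub>r\<^sub>i\<^sub>f\<^sub>t"
proof -
  interpret information_quantities J\<^sub>I\<^sub>I J\<^sub>I J by (rule information)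
  show ?thesis
    by (rule le_cam_equivalent_gaussian[OF gaussian_experiment_shift[OF shift]
          gaussian_experiment_drift[OF drift] cov_form_shift_drift])
qed

end
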